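(* Let $(V_o,w_o,\mu_o)$ be a simple weighted graph with an adapted weight $\sigma_o$ and associated adapted path metric $d_{\sigma_o}$, fix $\bar{x}\in V_o$, and let $(X^o_t)_{t\ge0}$ be the associated minimal Markov chain. Assume that \[C_o:=\inf_{x\in V_o}\mu_o(x)>0\] and that \[\int^{\infty}\frac{r\,dr}{\log\mu_o\big(B_{d_{\sigma_o}}(\bar{x},r)\big)}=\infty,\] where $\int^\infty$ means that the integral diverges at $\infty$. Then: (1) $(X^o_t)_{t\ge0}$ is conservative; (2) there exist constants $c>0$ and $\hat R\ge1$ such that the inverse function $\psi^{-1}(t)$ of \[\psi(R)=c\int_{\hat R}^{R}\frac{r\,dr}{\log\mu_o\big(B_{d_{\sigma_o}}(\bar{x},r)\big)+\log\log r}\] is an upper rate function for $(X^o_t)_{t\ge0}$ with respect to $d_{\sigma_o}$.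
   Context: A simple weighted graph $(V,w,\mu)$ consists of a countably infinite set $V$, a symmetric function $w:V\times V\to[0,\infty)$ and a function $\mu:V\to(0,\infty)$. The edge set is $E=\{(x,y):w(x,y)>0\}$, and one writes $x\sim y$ when $(x,y)\in E$. The graph $(V,E)$ is assumed to be locally finite, connected, undirected, and without loops or multiple edges. The associated Markov chain is the minimal continuous-time Markov chain with $Q$-matrix $q_{xy}=w(x,y)/\mu(x)$ for $x\neq y$ and $q_{xx}=-\frac{1}{\mu(x)}\sum_{y}w(x,y)$. Equivalently, it is the Hunt process of the minimal regular Dirichlet form on $L^2(V,\mu)$. It has lifetime $\zeta$ (the time of the accumulation of infinitely many jumps) and laws $\mathbb P_x$. The chain is conservative if $\mathbb P_x(\zeta<\infty)=0$ for all $x$. An adapted weight is a symmetric function $\sigma:E\to(0,1]$ with $\frac{1}{\mu(x)}\sum_{y}w(x,y)\sigma(x,y)^2\le1$ for all $x\in V$. The adapted path metric is \[d_\sigma(x,y)=\inf\Big\{\sum_{i=0}^{n-1}\sigma(x_i,x_{i+1})\Big\},\] where the infimum is over paths $x=x_0\sim x_1\sim\cdots\sim x_n=y$. Closed balls are $B_d(x,r)=\{y:d(x,y)\le r\}$. Given a reference point $\bar x$ and a metric $d$ on $V$, a nonnegative increasing function $R(t)$ is an upper rate function for the chain $(X_t)$ with respect to $d$ if there is a random time $T<\zeta$ with $\mathbb P_{\bar x}\big(d(X_t,\bar x)\le R(t)\text{ for all }T\le t<\zeta\big)=1$. *)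

theory Defs
  imports "HOL-Probability.Probability"
begin

section \<open>Simple weighted graphs\<close>

text \<open>Vertices are the elements of a countable type 'v (the set V is UNIV).
  Edge weights w, vertex measure mu.\<close>

definition simple_weighted_graph :: "('v::countable \<Rightarrow> 'v \<Rightarrow> real) \<Rightarrow> ('v \<Rightarrow> real) \<Rightarrow> bool" where
  "simple_weighted_graph w \<mu> \<longleftrightarrow>
     infinite (UNIV :: 'v set) \<and>
     (\<forall>x y. w x y = w y x) \<and>
     (\<forall>x y. 0 \<le> w x y) \<and>
     (\<forall>x. \<mu> x > 0) \<and>
     (\<forall>x. w x x = 0) \<and>
     (\<forall>x. finite {y. w x y > 0}) \<and>
     (\<forall>x y. (x, y) \<in> {(a, b). w a b > 0}\<^sup>*)"

definition wdeg :: "('v \<Rightarrow> 'v \<Rightarrow> real) \<Rightarrow> 'v \<Rightarrow> real" where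
  "wdeg w x = (\<Sum>y\<in>{y. w x y > 0}. w x y)"

section \<open>Adapted weights and adapted path metric\<close>

definition adapted_weight :: "('v \<Rightarrow> 'v \<Rightarrow> real) \<Rightarrow> ('v \<Rightarrow> real) \<Rightarrow> ('v \<Rightarrow> 'v \<Rightarrow> real) \<Rightarrow> bool" where
  "adapted_weight w \<mu> \<sigma> \<longleftrightarrow>
     (\<forall>x y. w x y > 0 \<longrightarrow> \<sigma> x y = \<sigma> y x \<and> 0 < \<sigma> x y \<and> \<sigma> x y \<le> 1) \<and>
     (\<forall>x. (\<Sum>y\<in>{y. w x y > 0}. w x y * (\<sigma> x y)\<^sup>2) / \<mu> x \<le> 1)"

text \<open>A path x = p!0 ~ p!1 ~ ... ~ p!(length p - 1) = y.\<close>
definition is_path :: "('v \<Rightarrow> 'v \<Rightarrow> real) \<Rightarrow> 'v list \<Rightarrow> 'v \<Rightarrow> 'v \<Rightarrow> bool" where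
  "is_path w p x y \<longleftrightarrow> p \<noteq> [] \<and> hd p = x \<and> last p = y \<and>
     (\<forall>i. Suc i < length p \<longrightarrow> w (p ! i) (p ! Suc i) > 0)"

definition path_length :: "('v \<Rightarrow> 'v \<Rightarrow> real) \<Rightarrow> 'v list \<Rightarrow> real" where
  "path_length \<sigma> p = (\<Sum>i<length p - 1. \<sigma> (p ! i) (p ! Suc i))"

definition adapted_path_metric :: "('v \<Rightarrow> 'v \<Rightarrow> real) \<Rightarrow> ('v \<Rightarrow> 'v \<Rightarrow> real) \<Rightarrow> 'v \<Rightarrow> 'v \<Rightarrow> real" where
  "adapted_path_metric w \<sigma> x y = Inf {path_length \<sigma> p | p. is_path w p x y}"

text \<open>mu of the closed ball B_d(x, r), as an extended nonnegative real (may be infinite).\<close>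
definition ball_measure :: "('v \<Rightarrow> real) \<Rightarrow> ('v \<Rightarrow> 'v \<Rightarrow> real) \<Rightarrow> 'v \<Rightarrow> real \<Rightarrow> ennreal" where
  "ball_measure \<mu> d x r = (\<integral>\<^sup>+ y. ennreal (\<mu> y) \<partial>count_space {y. d x y \<le> r})"

text \<open>1 / (log V + a), with the convention 1/log(infinity) = 0.\<close>
definition inv_log_plus :: "ennreal \<Rightarrow> real \<Rightarrow> real" where
  "inv_log_plus V a = (if V = \<infinity> then 0 else 1 / (ln (enn2real V) + a))"

section \<open>The minimal Markov chain (jump-chain / holding-time construction)\<close>

text \<open>Jump probabilities of the embedded chain and jump rates q(x) = -q_xx.\<close>
definition jump_prob :: "('v \<Rightarrow> 'v \<Rightarrow> real) \<Rightarrow> 'v \<Rightarrow> 'v \<Rightarrow> real" where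
  "jump_prob w x y = w x y / wdeg w x"

definition jump_rate :: "('v \<Rightarrow> 'v \<Rightarrow> real) \<Rightarrow> ('v \<Rightarrow> real) \<Rightarrow> 'v \<Rightarrow> real" where
  "jump_rate w \<mu> x = wdeg w x / \<mu> x"

text \<open>Y: embedded jump chain started at x0; E: i.i.d. Exp(1) variables independent of Y.
  The finite-dimensional formula below determines the joint law of (Y, E) completely.\<close>
definition minimal_chain :: "('v \<Rightarrow> 'v \<Rightarrow> real) \<Rightarrow> ('v \<Rightarrow> real) \<Rightarrow> 'v \<Rightarrow> 'w measure \<Rightarrow>
    (nat \<Rightarrow> 'w \<Rightarrow> 'v) \<Rightarrow> (nat \<Rightarrow> 'w \<Rightarrow> real) \<Rightarrow> bool" where
  "minimal_chain w \<mu> x0 M Y E \<longleftrightarrow>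
     prob_space M \<and>
     (\<forall>n. Y n \<in> measurable M (count_space UNIV)) \<and>
     (\<forall>n. E n \<in> borel_measurable M) \<and>
     (\<forall>n (xs :: nat \<Rightarrow> 'v) (ts :: nat \<Rightarrow> real). (\<forall>i\<le>n. 0 \<le> ts i) \<longrightarrow>
        measure M {\<omega> \<in> space M. \<forall>i\<le>n. Y i \<omega> = xs i \<and> E i \<omega> > ts i}
        = (if xs 0 = x0 then 1 else 0) * (\<Prod>i<n. jump_prob w (xs i) (xs (Suc i)))
          * (\<Prod>i\<le>n. exp (- ts i)))"

text \<open>Holding times S_n = E_n / q(Y_n), jump times J_n, lifetime zeta = sup J_n.\<close>
definition jump_time :: "('v \<Rightarrow> 'v \<Rightarrow> real) \<Rightarrow> ('v \<Rightarrow> real) \<Rightarrow> (nat \<Rightarrow> 'w \<Rightarrow> 'v) \<Rightarrow>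
    (nat \<Rightarrow> 'w \<Rightarrow> real) \<Rightarrow> nat \<Rightarrow> 'w \<Rightarrow> real" where
  "jump_time w \<mu> Y E n \<omega> = (\<Sum>k<n. E k \<omega> / jump_rate w \<mu> (Y k \<omega>))"

definition lifetime :: "('v \<Rightarrow> 'v \<Rightarrow> real) \<Rightarrow> ('v \<Rightarrow> real) \<Rightarrow> (nat \<Rightarrow> 'w \<Rightarrow> 'v) \<Rightarrow>
    (nat \<Rightarrow> 'w \<Rightarrow> real) \<Rightarrow> 'w \<Rightarrow> ereal" where
  "lifetime w \<mu> Y E \<omega> = (SUP n. ereal (jump_time w \<mu> Y E n \<omega>))"

text \<open>X_t = Y_n for J_n \<le> t < J_(n+1); only meaningful for 0 \<le> t < zeta.\<close>
definition chain_state :: "('v \<Rightarrow> 'v \<Rightarrow> real) \<Rightarrow> ('v \<Rightarrow> real) \<Rightarrow> (nat \<Rightarrow> 'w \<Rightarrow> 'v) \<Rightarrow>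
    (nat \<Rightarrow> 'w \<Rightarrow> real) \<Rightarrow> real \<Rightarrow> 'w \<Rightarrow> 'v" where
  "chain_state w \<mu> Y E t \<omega> = Y (LEAST n. t < jump_time w \<mu> Y E (Suc n) \<omega>) \<omega>"

definition conservative :: "'w itself \<Rightarrow> ('v \<Rightarrow> 'v \<Rightarrow> real) \<Rightarrow> ('v \<Rightarrow> real) \<Rightarrow> bool" where
  "conservative (_ :: 'w itself) w \<mu> \<longleftrightarrow>
     (\<forall>x (M :: 'w measure) Y E. minimal_chain w \<mu> x M Y E \<longrightarrow>
        (AE \<omega> in M. lifetime w \<mu> Y E \<omega> = \<infinity>))"

definition upper_rate_function :: "'w itself \<Rightarrow> ('v \<Rightarrow> 'v \<Rightarrow> real) \<Rightarrow> ('v \<Rightarrow> real) \<Rightarrow> 'v \<Rightarrow>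
    ('v \<Rightarrow> 'v \<Rightarrow> real) \<Rightarrow> (real \<Rightarrow> real) \<Rightarrow> bool" where
  "upper_rate_function (_ :: 'w itself) w \<mu> xbar d R \<longleftrightarrow>
     (\<forall>t\<ge>0. R t \<ge> 0) \<and> mono_on {0..} R \<and>
     (\<forall>(M :: 'w measure) Y E. minimal_chain w \<mu> xbar M Y E \<longrightarrow>
        (\<exists>T. T \<in> borel_measurable M \<and>
          (AE \<omega> in M. 0 \<le> T \<omega> \<and> ereal (T \<omega>) < lifetime w \<mu> Y E \<omega> \<and>
             (\<forall>t. T \<omega> \<le> t \<and> ereal t < lifetime w \<mu> Y E \<omega> \<longrightarrow>
                d (chain_state w \<mu> Y E t \<omega>) xbar \<le> R t))))"

end

theory Submission
  imports Defs
begin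

text \<open>Direct Gaussian estimates fail for long jumps, so the argument passes through the metric graph
  whose edges have length \<open>\<sigma>\<close>. For \<open>s > 0\<close> let \<open>h\<close> be the restriction to the vertices of the
  solution of \<open>\<Delta>h = s\<^sup>2 h\<close> in a ball of radius \<open>R\<close> with value \<open>1\<close> outside. A weighted energy
  (Agmon) estimate together with \<open>\<mu> \<ge> C\<^sub>o\<close> gives \<open>h \<le> 1 / V(R)\<close> on the ball of radius \<open>R / 2\<close>
  when \<open>s\<close> is a multiple of \<open>log V(R) / R\<close>. On long edges \<open>h\<close> is not a supersolution for the
  jump process, but its small power \<open>h\<^sup>\<theta>\<close> with \<open>\<theta> \<approx> min 1 (1 / s)\<close> is one at rate \<open>O(\<theta> s\<^sup>2)\<close>.
  Hence the time to pass from radius \<open>4\<^sup>n\<close> to \<open>4\<^sup>n\<^sup>+\<^sup>1\<close> is below a multiple of \<open>R\<^sup>2 / log V(R)\<close>,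
  \<open>R = 4\<^sup>n\<^sup>+\<^sup>1\<close>, only with summable probability. By Borel-Cantelli the passage times eventually
  exceed these values, whose sum diverges and is comparable with \<open>\<psi>\<close>. The volume is at least
  linear, so the term \<open>log log r\<close> is harmless.\<close>

section \<open>Inequalities for hyperbolic functions\<close>

text \<open>Write \<open>L = log V(R)\<close>. The hypothesis allows \<open>L\<close> as large as
  \<open>R^2 log R\<close>, so the rate \<open>s = 16 L / R\<close> may be unbounded while \<sigma>
  stays of order 1. A test function \<open>exp (s d)\<close> then costs a factor of order
  \<open>exp (s \<sigma>)\<close> on an edge, whereas the adapted condition pays only for
  \<open>(s \<sigma>)^2\<close>. On the metric graph each edge carries the factor
  \<open>k / sinh k\<close> with \<open>k = s \<sigma>\<close>, which cancels this exponential.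
  Taking a power \<theta> reduces the decay to \<open>exp (- \<theta> L)\<close> and the rate to
  \<open>4 \<theta> s^2\<close>. Both are linear in \<theta>, so the admissible time
  \<open>L / (8 s^2)\<close>, a multiple of \<open>R^2 / L\<close>, is unaffected and uses up half
  of the exponent. Only the probability gets worse, and it stays summable:
  \<open>\<theta> L = min (L / 4) (R / 32)\<close> is at least linear in \<open>n\<close> for
  \<open>R = 4^(n+1)\<close>. The passage between two balls is handled by a supermartingale on the
  lists of visited vertices. Such a list records whether the inner or the outer ball has been left,
  which takes the place of the strong Markov property.\<close>

lemma nonneg_from_deriv:
  fixes f f' :: "real \<Rightarrow> real"
  assumes "0 \<le> x" "f 0 = 0"
    and "\<And>y. (f has_real_derivative f' y) (at y)" "\<And>y. 0 \<le> y \<Longrightarrow> 0 \<le> f' y"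
  shows "0 \<le> f x"
  using DERIV_nonneg_imp_nondecreasing[of 0 x f] assms by metis

lemma le_sinh_real:
  fixes x :: real assumes "0 \<le> x" shows "x \<le> sinh x"
proof -
  have "0 \<le> sinh x - x"
    by (rule nonneg_from_deriv[of x _ "\<lambda>x. cosh x - 1"])
       (use assms in \<open>auto intro!: derivative_eq_intros simp: cosh_real_ge_1\<close>)
  then show ?thesis by simp
qed

lemma sinh_le_mult_cosh_real:
  fixes x :: real assumes "0 \<le> x" shows "sinh x \<le> x * cosh x"
proof -
  have "0 \<le> x * cosh x - sinh x"
    by (rule nonneg_from_deriv[of x _ "\<lambda>x. x * sinh x"])
       (use assms in \<open>auto intro!: derivative_eq_intros\<close>)
  then show ?thesis by simp
qed

text \<open>Applied as \<open>k / sinh k * cosh k \<le> 1 + k\<^sup>2\<close>: the diagonal term of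
  an edge exceeds 1 by a quadratic error only, however large \<open>k\<close> is.\<close>

lemma mult_cosh_le_sinh_real:
  fixes x :: real assumes "0 \<le> x" shows "x * cosh x \<le> (1 + x\<^sup>2) * sinh x"
proof -
  have "0 \<le> (1 + x\<^sup>2) * sinh x - x * cosh x"
    by (rule nonneg_from_deriv[of x _ "\<lambda>x. x\<^sup>2 * cosh x + x * sinh x"])
       (use assms in \<open>auto intro!: derivative_eq_intros simp: algebra_simps\<close>)
  then show ?thesis by simp
qed

lemma cosh_minus_one_le_real:
  fixes x :: real assumes "0 \<le> x" shows "2 * (cosh x - 1) \<le> x * sinh x"
proof -
  have "0 \<le> x * sinh x - 2 * (cosh x - 1)"
    by (rule nonneg_from_deriv[of x _ "\<lambda>x. x * cosh x - sinh x"])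
       (use assms sinh_le_mult_cosh_real in \<open>auto intro!: derivative_eq_intros\<close>)
  then show ?thesis by simp
qed

text \<open>Applied as \<open>ln (sinh k / k) \<le> k\<^sup>2\<close>. Differentiation reduces it to
  \<open>cosh y \<le> exp (y\<^sup>2)\<close>, which follows from
  \<open>cosh y \<le> 1 + y\<^sup>2\<close> up to \<open>y = 1\<close> and from
  \<open>y \<le> y\<^sup>2\<close> beyond.\<close>

lemma sinh_le_mult_exp_square:
  fixes x :: real assumes "0 \<le> x" shows "sinh x \<le> x * exp (x\<^sup>2)"
proof -
  have "0 \<le> x * exp (x\<^sup>2) - sinh x"
  proof (rule nonneg_from_deriv[of x _ "\<lambda>x. exp (x\<^sup>2) + 2 * x\<^sup>2 * exp (x\<^sup>2) - cosh x"])
    show "((\<lambda>x. x * exp (x\<^sup>2) - sinh x) has_real_derivative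
        exp (y\<^sup>2) + 2 * y\<^sup>2 * exp (y\<^sup>2) - cosh y) (at y)" for y :: real
      by (auto intro!: derivative_eq_intros simp: algebra_simps power2_eq_square)
    fix y :: real assume y: "0 \<le> y"
    have "0 \<le> exp (y\<^sup>2) - cosh y"
    proof -
      have "0 \<le> exp (y\<^sup>2) * 1 - cosh y"
      proof (cases "y \<le> 1")
        case True
        have "0 \<le> 1 + y\<^sup>2 - cosh y"
        proof -
          have e1: "exp y \<le> 1 + y + y\<^sup>2" using exp_bound y True by blast
          have "0 \<le> 1 - y + y\<^sup>2 - exp (- y)"
          proof (rule nonneg_from_deriv[of y _ "\<lambda>y. - 1 + 2 * y + exp (- y)"])
            show "0 \<le> - 1 + 2 * z + exp (- z)" if "0 \<le> z" for z :: real
              using exp_ge_add_one_self[of "- z"] that by linarith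
          qed (use y in \<open>auto intro!: derivative_eq_intros\<close>)
          with e1 show ?thesis by (simp add: cosh_def field_simps)
        qed
        then show ?thesis using exp_ge_add_one_self[of "y\<^sup>2"] by linarith
      next
        case False
        then have "y \<le> y\<^sup>2" by (simp add: power2_eq_square)
        then have "exp y \<le> exp (y\<^sup>2)" by simp
        moreover have "exp (- y) \<le> exp y" using y by simp
        ultimately have "exp y + exp (- y) \<le> exp (y\<^sup>2) * 2" by linarith
        then show ?thesis by (simp add: cosh_def)
      qed
      then show ?thesis by simp
    qed
    then show "0 \<le> exp (y\<^sup>2) + 2 * y\<^sup>2 * exp (y\<^sup>2) - cosh y"
      by (smt (verit, best) mult_nonneg_nonneg exp_ge_zero zero_le_power2)
  qed (use assms in auto)
  then show ?thesis by simp
qed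

text \<open>With \<open>z = exp (x / 4)\<close> the right side is half the square of
  \<open>z\<^sup>2 - 1 / z\<^sup>2\<close>, and this difference is at least
  \<open>2 * (z - 1)\<close>. It fixes the exponent \<open>s / 4\<close> of the Agmon weight: one
  edge may change that weight by at most the factor \<open>exp (k / 4)\<close>.\<close>

lemma exp_quarter_le_cosh:
  fixes x :: real assumes "0 \<le> x" shows "(exp (x / 4) - 1)\<^sup>2 \<le> cosh x - 1"
proof -
  define z where "z = exp (x / 4)"
  have z: "1 \<le> z" using assms by (simp add: z_def)
  have z4: "exp x = z ^ 4" using exp_of_nat_mult[of 4 "x / 4"] by (simp add: z_def)
  then have z4': "exp (- x) = 1 / z ^ 4" by (simp add: exp_minus divide_inverse)
  have "(z\<^sup>2 - 1 / z\<^sup>2)\<^sup>2 = (z\<^sup>2)\<^sup>2 + (1 / z\<^sup>2)\<^sup>2 - 2 * (z\<^sup>2 * (1 / z\<^sup>2))"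
    by (simp only: power2_diff mult.assoc)
  also have "\<dots> = z ^ 4 + 1 / z ^ 4 - 2" using z by (simp add: power_divide)
  finally have c: "cosh x - 1 = (z\<^sup>2 - 1 / z\<^sup>2)\<^sup>2 / 2"
    by (simp add: cosh_def z4 z4')
  have "1 / z\<^sup>2 \<le> 1" using z by (simp add: field_simps)
  moreover have "z\<^sup>2 - 1 \<ge> 2 * (z - 1)"
    using zero_le_power2[of "z - 1"] by (simp add: power2_eq_square algebra_simps)
  ultimately have "2 * (z - 1) \<le> z\<^sup>2 - 1 / z\<^sup>2" by linarith
  then have "(2 * (z - 1))\<^sup>2 \<le> (z\<^sup>2 - 1 / z\<^sup>2)\<^sup>2" using z by (intro power_mono) auto
  moreover have "(2 * (z - 1))\<^sup>2 = 4 * (z - 1)\<^sup>2" by (simp only: power_mult_distrib) simp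
  moreover have "0 \<le> (z - 1)\<^sup>2" by simp
  ultimately have "(z - 1)\<^sup>2 \<le> cosh x - 1" unfolding c by linarith
  then show ?thesis by (simp add: z_def)
qed

text \<open>The contribution of one edge to the energy, divided by its weight: \<open>p\<close> and
  \<open>q\<close> are the values of the solution at the endpoints, and
  \<open>exp (b * \<rho>) - 1\<close> is the cutoff. Splitting
  \<open>p q (s\<^sup>2 + r\<^sup>2)\<close> into the cross term \<open>2 p q s r\<close> and
  \<open>p q (r - s)\<^sup>2\<close>, the factor \<open>cosh k\<close> absorbs everything but a
  constant, and \<open>k / sinh k\<close> times that constant is at most \<open>k\<^sup>2\<close>,
  the quantity controlled by the adapted condition.\<close>

lemma agmon_edge_bound_ordered:
  fixes p q k b \<rho>1 \<rho>2 :: real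
  assumes p: "0 \<le> p" "p \<le> 1" and q: "0 \<le> q" "q \<le> 1" and k: "0 < k" and b: "0 \<le> b"
    and \<rho>: "0 \<le> \<rho>1" "\<rho>1 \<le> \<rho>2" "b * (\<rho>2 - \<rho>1) \<le> k / 4"
  shows "k / sinh k * (p * q * ((exp (b * \<rho>1) - 1)\<^sup>2 + (exp (b * \<rho>2) - 1)\<^sup>2)
      - cosh k * (p\<^sup>2 * (exp (b * \<rho>1) - 1)\<^sup>2 + q\<^sup>2 * (exp (b * \<rho>2) - 1)\<^sup>2)) \<le> k\<^sup>2"
proof -
  define s where "s = exp (b * \<rho>1) - 1"
  define r where "r = exp (b * \<rho>2) - 1"
  define e where "e = exp (k / 4) - 1"
  have sr: "0 \<le> s" "s \<le> r" using \<rho> b by (auto simp: s_def r_def mult_left_mono)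
  have e0: "0 \<le> e" using k by (simp add: e_def)
  have ec: "e\<^sup>2 \<le> cosh k - 1" using exp_quarter_le_cosh[of k] k by (simp add: e_def)
  have "r - s = (s + 1) * (exp (b * (\<rho>2 - \<rho>1)) - 1)"
    by (simp add: s_def r_def algebra_simps flip: exp_add)
  also have "\<dots> \<le> (s + 1) * e"
    using sr \<rho>(3) by (intro mult_left_mono) (auto simp: e_def)
  finally have "(r - s)\<^sup>2 \<le> ((s + 1) * e)\<^sup>2" using sr by (intro power_mono) auto
  also have "\<dots> = e\<^sup>2 * (s + 1)\<^sup>2" by (simp add: power_mult_distrib)
  \<comment> \<open>The product \<open>s * r\<close>, multiplied by \<open>p * q\<close>, can be
    absorbed into \<open>N\<close>. The remaining 1 comes from the \<open>- 1\<close> in the cutoff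
    and is handled by \<open>p * q \<le> 1\<close>.\<close>
  also have "\<dots> \<le> e\<^sup>2 * (2 * (s * r + 1))"
  proof (intro mult_left_mono)
    have "s * s \<le> s * r" using sr by (simp add: mult_left_mono)
    moreover have "0 \<le> (s - 1)\<^sup>2" by simp
    ultimately show "(s + 1)\<^sup>2 \<le> 2 * (s * r + 1)" by (simp add: power2_eq_square algebra_simps)
  qed simp
  finally have rs: "(r - s)\<^sup>2 \<le> e\<^sup>2 * (2 * (s * r + 1))" .
  define N where "N = p\<^sup>2 * s\<^sup>2 + q\<^sup>2 * r\<^sup>2"
  have N: "2 * (p * q * (s * r)) \<le> N"
    using zero_le_power2[of "p * s - q * r"]
    by (simp add: N_def power2_eq_square algebra_simps)
  have N0: "0 \<le> N" by (simp add: N_def)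
  have pq: "0 \<le> p * q" "p * q \<le> 1" using p q by (auto intro: mult_le_one)
  have "p * q * (s\<^sup>2 + r\<^sup>2) = 2 * (p * q * (s * r)) + p * q * (r - s)\<^sup>2"
    by (simp add: power2_eq_square algebra_simps)
  also have "\<dots> \<le> 2 * (p * q * (s * r)) + p * q * (e\<^sup>2 * (2 * (s * r + 1)))"
    using rs pq by (simp add: mult_left_mono)
  also have "\<dots> = (1 + e\<^sup>2) * (2 * (p * q * (s * r))) + 2 * e\<^sup>2 * (p * q)"
    by (simp add: algebra_simps)
  also have "\<dots> \<le> (1 + e\<^sup>2) * N + 2 * e\<^sup>2"
    using N pq by (intro add_mono mult_left_mono mult_left_le) auto
  also have "\<dots> \<le> cosh k * N + 2 * (cosh k - 1)"
    using ec N0 by (intro add_mono mult_right_mono) auto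
  finally have "p * q * (s\<^sup>2 + r\<^sup>2) - cosh k * N \<le> 2 * (cosh k - 1)" by simp
  also have "\<dots> \<le> k * sinh k" using cosh_minus_one_le_real k by simp
  finally have "k / sinh k * (p * q * (s\<^sup>2 + r\<^sup>2) - cosh k * N) \<le> k / sinh k * (k * sinh k)"
    using k by (intro mult_left_mono) auto
  also have "\<dots> = k\<^sup>2" using k by (simp add: power2_eq_square)
  finally show ?thesis by (simp add: s_def r_def N_def)
qed

lemma agmon_edge_bound:
  fixes p q k b \<rho>1 \<rho>2 :: real
  assumes p: "0 \<le> p" "p \<le> 1" and q: "0 \<le> q" "q \<le> 1" and k: "0 < k" and b: "0 \<le> b"
    and \<rho>: "0 \<le> \<rho>1" "0 \<le> \<rho>2" "b * \<bar>\<rho>1 - \<rho>2\<bar> \<le> k / 4"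
  shows "k / sinh k * (p * q * ((exp (b * \<rho>1) - 1)\<^sup>2 + (exp (b * \<rho>2) - 1)\<^sup>2)
      - cosh k * (p\<^sup>2 * (exp (b * \<rho>1) - 1)\<^sup>2 + q\<^sup>2 * (exp (b * \<rho>2) - 1)\<^sup>2)) \<le> k\<^sup>2"
proof (cases "\<rho>1 \<le> \<rho>2")
  case True
  then show ?thesis using agmon_edge_bound_ordered[OF p q k b] \<rho> by auto
next
  case False
  then show ?thesis using agmon_edge_bound_ordered[OF q p k b, of \<rho>2 \<rho>1] \<rho>
    by (auto simp: algebra_simps)
qed

text \<open>Compares one jump of the chain with one edge of the metric graph; \<open>E\<close> is
  the ratio of the values at the endpoints. Convexity of \<open>exp\<close> (weighted
  arithmetic-geometric mean) bounds \<open>E powr \<theta>\<close> by an affine function of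
  \<open>k / sinh k * E\<close>. Of the error \<open>3 * \<theta> * k\<^sup>2\<close>, two parts
  come from compensating the factor \<open>k / sinh k\<close> and one from
  \<open>k * coth k \<le> 1 + k\<^sup>2\<close>.\<close>

lemma power_transform_edge_bound:
  fixes k \<theta> E :: real
  assumes k: "0 < k" and \<theta>: "0 < \<theta>" "\<theta> \<le> 1 / 4" "\<theta> * k \<le> 1 / 2" and E: "0 < E"
  shows "E powr \<theta> - 1 \<le> \<theta> * (k / sinh k * (E - cosh k)) + 3 * \<theta> * k\<^sup>2"
proof -
  define \<nu> where "\<nu> = ln (sinh k / k)"
  \<comment> \<open>The value that makes the weighted mean of \<open>u\<close> and
    \<open>\<delta> - \<nu>\<close> equal to \<open>\<theta> * \<delta>\<close>, so that the loss
    \<nu> cancels.\<close>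
  define u where "u = \<theta> * \<nu> / (1 - \<theta>)"
  define \<delta> where "\<delta> = ln E"
  have shk: "0 < sinh k" using k by simp
  have e\<nu>: "exp \<nu> = sinh k / k" using k by (simp add: \<nu>_def)
  have \<nu>0: "0 \<le> \<nu>" using le_sinh_real[of k] k by (simp add: \<nu>_def)
  have \<nu>2: "\<nu> \<le> k\<^sup>2"
  proof -
    have "exp \<nu> \<le> exp (k\<^sup>2)" using sinh_le_mult_exp_square[of k] k by (simp add: e\<nu> field_simps)
    then show ?thesis by simp
  qed
  \<comment> \<open>The linear bound serves long edges: with \<open>\<theta> * k \<le> 1 / 2\<close>
    it keeps \<open>u \<le> 1\<close>, so \<open>exp u\<close> can be linearised. The quadratic
    bound \<open>\<nu>2\<close> then gives the rate.\<close>
  have \<nu>1: "\<nu> \<le> k"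
  proof -
    have "cosh k \<le> exp k" using k by (simp add: cosh_def)
    then have "sinh k \<le> k * exp k" using sinh_le_mult_cosh_real[of k] k
      by (meson less_imp_le mult_left_mono order_trans)
    then have "exp \<nu> \<le> exp k" using k by (simp add: e\<nu> field_simps)
    then show ?thesis by simp
  qed
  have u0: "0 \<le> u" using \<theta> \<nu>0 by (simp add: u_def)
  have "\<theta> * \<nu> \<le> 1 / 2" using mult_left_mono[OF \<nu>1, of \<theta>] \<theta> by linarith
  then have u1: "u \<le> 1" using \<theta> by (simp add: u_def field_simps)
  have "u\<^sup>2 \<le> u" using u0 u1 by (simp add: power2_eq_square mult_left_le)
  then have eu: "exp u \<le> 1 + 2 * u" using exp_bound[OF u0 u1] by linarith
  have "(1 - \<theta>) * exp u \<le> (1 - \<theta>) * (1 + 2 * u)" using eu \<theta> by (intro mult_left_mono) auto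
  also have "\<dots> = 1 - \<theta> + 2 * \<theta> * \<nu>" using \<theta> by (simp add: u_def field_simps)
  also have "\<dots> \<le> 1 - \<theta> + 2 * \<theta> * k\<^sup>2" using \<nu>2 \<theta> by (simp add: mult_left_mono)
  finally have A: "(1 - \<theta>) * exp u \<le> 1 - \<theta> + 2 * \<theta> * k\<^sup>2" .
  have "exp ((1 - \<theta>) * u + \<theta> * (\<delta> - \<nu>)) \<le> (1 - \<theta>) * exp u + \<theta> * exp (\<delta> - \<nu>)"
    using convex_onD[OF exp_convex, of \<theta> u "\<delta> - \<nu>"] \<theta> by simp
  moreover have "(1 - \<theta>) * u + \<theta> * (\<delta> - \<nu>) = \<theta> * \<delta>" using \<theta> by (simp add: u_def field_simps)
  moreover have "exp (\<theta> * \<delta>) = E powr \<theta>" using E by (simp add: \<delta>_def powr_def)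
  moreover have "exp (\<delta> - \<nu>) = k / sinh k * E" using E k by (simp add: exp_diff e\<nu> \<delta>_def)
  ultimately have B: "E powr \<theta> \<le> 1 - \<theta> + 2 * \<theta> * k\<^sup>2 + \<theta> * (k / sinh k * E)" using A by simp
  have "k / sinh k * cosh k \<le> 1 + k\<^sup>2"
    using mult_cosh_le_sinh_real[of k] k shk by (simp add: pos_divide_le_eq)
  then have "\<theta> * (k / sinh k * cosh k) \<le> \<theta> * (1 + k\<^sup>2)" using \<theta> by (intro mult_left_mono) auto
  then show ?thesis using B unfolding right_diff_distrib distrib_left by linarith
qed

section \<open>Supersolutions for the exit from a ball\<close>

text \<open>In the theorem \<open>finite_ball\<close> is obtained from the divergence of the
  integral. It turns the boundary value problems and energy sums below into finite sums.\<close>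

locale adapted_graph =
  fixes w :: "'v::countable \<Rightarrow> 'v \<Rightarrow> real" and \<mu> :: "'v \<Rightarrow> real"
    and \<sigma> :: "'v \<Rightarrow> 'v \<Rightarrow> real" and xbar :: 'v and C0 :: real
  assumes graph: "simple_weighted_graph w \<mu>"
    and adapted: "adapted_weight w \<mu> \<sigma>"
    and C0: "0 < C0" "\<And>x. C0 \<le> \<mu> x"
    and finite_ball: "\<And>r. finite {y. adapted_path_metric w \<sigma> xbar y \<le> r}"
begin

definition nbr :: "'v \<Rightarrow> 'v set" where "nbr x = {y. 0 < w x y}"

definition dist0 :: "'v \<Rightarrow> real" where "dist0 = adapted_path_metric w \<sigma> xbar"

definition Bl :: "real \<Rightarrow> 'v set" where "Bl r = {y. dist0 y \<le> r}"

definition vol :: "real \<Rightarrow> real" where "vol r = (\<Sum>y\<in>Bl r. \<mu> y)"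

lemma w_sym: "w x y = w y x"
  and w_nonneg: "0 \<le> w x y"
  and mu_pos: "0 < \<mu> x"
  and finite_nbr: "finite (nbr x)"
  and connected: "(x, y) \<in> {(a, b). 0 < w a b}\<^sup>*"
  and infinite_UNIV: "infinite (UNIV :: 'v set)"
  using graph unfolding simple_weighted_graph_def nbr_def by blast+

lemma sigma_sym: "0 < w x y \<Longrightarrow> \<sigma> x y = \<sigma> y x"
  and sigma_pos: "0 < w x y \<Longrightarrow> 0 < \<sigma> x y"
  and sigma_le_1: "0 < w x y \<Longrightarrow> \<sigma> x y \<le> 1"
  using adapted unfolding adapted_weight_def by blast+

lemma adapted_sum: "(\<Sum>y\<in>nbr x. w x y * (\<sigma> x y)\<^sup>2) \<le> \<mu> x"
proof -
  have "(\<Sum>y\<in>nbr x. w x y * (\<sigma> x y)\<^sup>2) / \<mu> x \<le> 1"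
    using adapted unfolding adapted_weight_def nbr_def by blast
  then show ?thesis using mu_pos[of x] by (simp add: divide_le_eq_1_pos)
qed

lemma wdeg_eq: "wdeg w x = (\<Sum>y\<in>nbr x. w x y)"
  by (simp add: wdeg_def nbr_def)

lemma nbr_nonempty: "nbr x \<noteq> {}"
proof -
  obtain y where "y \<noteq> x" using infinite_UNIV
    by (metis UNIV_eq_I finite.emptyI finite_insert insert_iff)
  with connected[of x y] show ?thesis
    by (auto simp: nbr_def elim: converse_rtranclE)
qed

lemma wdeg_pos: "0 < wdeg w x"
  unfolding wdeg_eq using finite_nbr nbr_nonempty by (intro sum_pos) (auto simp: nbr_def)

lemma jump_rate_pos: "0 < jump_rate w \<mu> x"
  by (simp add: jump_rate_def wdeg_pos mu_pos)

lemma jump_prob_nonneg: "0 \<le> jump_prob w x y"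
  by (simp add: jump_prob_def w_nonneg wdeg_pos less_imp_le)

lemma jump_prob_zero: "y \<notin> nbr x \<Longrightarrow> jump_prob w x y = 0"
  using w_nonneg[of x y] by (simp add: jump_prob_def nbr_def)

lemma sum_jump_prob: "(\<Sum>y\<in>nbr x. jump_prob w x y) = 1"
  using wdeg_pos[of x] by (simp add: jump_prob_def wdeg_eq flip: sum_divide_distrib)

section \<open>Paths and the distance from the base point\<close>

lemma path_length_nonneg: "is_path w p x y \<Longrightarrow> 0 \<le> path_length \<sigma> p"
  unfolding path_length_def is_path_def
  by (intro sum_nonneg) (auto intro!: less_imp_le[OF sigma_pos])

lemma is_path_snoc:
  assumes "is_path w p x y" "0 < w y z"
  shows "is_path w (p @ [z]) x z" and "path_length \<sigma> (p @ [z]) = path_length \<sigma> p + \<sigma> y z"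
proof -
  have p: "p \<noteq> []" "hd p = x" "last p = y" and
    e: "\<And>i. Suc i < length p \<Longrightarrow> 0 < w (p ! i) (p ! Suc i)"
    using assms(1) by (auto simp: is_path_def)
  have l: "p ! (length p - 1) = y" using p by (simp add: last_conv_nth)
  have "0 < w ((p @ [z]) ! i) ((p @ [z]) ! Suc i)" if "Suc i < length (p @ [z])" for i
  proof (cases "Suc i < length p")
    case True then show ?thesis using e by (simp add: nth_append)
  next
    case False
    then have "i = length p - 1" "Suc i = length p" using that p by auto
    then show ?thesis using l assms(2) p by (simp add: nth_append)
  qed
  then show "is_path w (p @ [z]) x z" using p by (simp add: is_path_def)
  obtain n where n: "length p = Suc n" using p by (cases p) auto
  have "path_length \<sigma> (p @ [z]) = (\<Sum>i<n. \<sigma> ((p @ [z]) ! i) ((p @ [z]) ! Suc i)) + \<sigma> y z"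
    using l n by (simp add: path_length_def nth_append)
  also have "(\<Sum>i<n. \<sigma> ((p @ [z]) ! i) ((p @ [z]) ! Suc i)) = path_length \<sigma> p"
    unfolding path_length_def using n by (intro sum.cong) (auto simp: nth_append)
  finally show "path_length \<sigma> (p @ [z]) = path_length \<sigma> p + \<sigma> y z" .
qed

lemma is_path_rev:
  assumes "is_path w p x y"
  shows "is_path w (rev p) y x" and "path_length \<sigma> (rev p) = path_length \<sigma> p"
proof -
  have p: "p \<noteq> []" "hd p = x" "last p = y" and
    e: "\<And>i. Suc i < length p \<Longrightarrow> 0 < w (p ! i) (p ! Suc i)"
    using assms(1) by (auto simp: is_path_def)
  have idx: "rev p ! i = p ! Suc (length p - 2 - i)" "rev p ! Suc i = p ! (length p - 2 - i)"
    if "Suc i < length p" for i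
    using that by (auto simp: rev_nth intro!: arg_cong[of _ _ "(!) p"])
  show "is_path w (rev p) y x"
    using p by (auto simp: is_path_def hd_rev last_rev idx w_sym[of "p ! Suc _"] intro!: e)
  have "path_length \<sigma> (rev p) = (\<Sum>i<length p - 1. \<sigma> (p ! (length p - 2 - i)) (p ! Suc (length p - 2 - i)))"
    unfolding path_length_def
    by (intro sum.cong) (auto simp: idx intro!: sigma_sym[symmetric] e)
  also have "\<dots> = path_length \<sigma> p"
    unfolding path_length_def
    by (rule sum.reindex_bij_witness[where i = "\<lambda>i. length p - 2 - i" and j = "\<lambda>i. length p - 2 - i"]) auto
  finally show "path_length \<sigma> (rev p) = path_length \<sigma> p" .
qed

lemma path_exists: "\<exists>p. is_path w p x y"
  using connected[of x y]
proof (induction rule: rtrancl_induct)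
  case base
  show ?case by (rule exI[of _ "[x]"]) (simp add: is_path_def)
next
  case (step y z)
  then show ?case using is_path_snoc(1) by blast
qed

lemma path_lengths: "{path_length \<sigma> p | p. is_path w p x y} \<noteq> {}"
    "bdd_below {path_length \<sigma> p | p. is_path w p x y}"
  using path_exists[of x y] path_length_nonneg[of _ x y] by (auto intro!: bdd_belowI[of _ 0])

lemma adapted_path_metric_sym: "adapted_path_metric w \<sigma> x y = adapted_path_metric w \<sigma> y x"
proof -
  have "{path_length \<sigma> p | p. is_path w p x y} \<subseteq> {path_length \<sigma> p | p. is_path w p y x}" for x y
  proof
    fix l assume "l \<in> {path_length \<sigma> p | p. is_path w p x y}"
    then obtain p where "is_path w p x y" "l = path_length \<sigma> p" by blast
    then have "is_path w (rev p) y x" "l = path_length \<sigma> (rev p)" using is_path_rev by simp_all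
    then show "l \<in> {path_length \<sigma> p | p. is_path w p y x}" by blast
  qed
  then have "{path_length \<sigma> p | p. is_path w p x y} = {path_length \<sigma> p | p. is_path w p y x}"
    by (intro equalityI) auto
  then show ?thesis by (simp add: adapted_path_metric_def)
qed

lemma dist0_nonneg: "0 \<le> dist0 x"
  unfolding dist0_def adapted_path_metric_def
  using path_lengths path_length_nonneg by (intro cInf_greatest) auto

lemma dist0_step: "0 < w x y \<Longrightarrow> dist0 y \<le> dist0 x + \<sigma> x y"
proof -
  assume xy: "0 < w x y"
  have "dist0 y - \<sigma> x y \<le> dist0 x"
    unfolding dist0_def adapted_path_metric_def[of _ _ _ x]
  proof (rule cInf_greatest[OF path_lengths(1)])
    fix l assume "l \<in> {path_length \<sigma> p | p. is_path w p xbar x}"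
    then obtain p where p: "is_path w p xbar x" "l = path_length \<sigma> p" by blast
    have "adapted_path_metric w \<sigma> xbar y \<le> l + \<sigma> x y"
      unfolding adapted_path_metric_def
      by (rule cInf_lower[OF _ path_lengths(2)]) (use is_path_snoc[OF p(1) xy] p(2) in force)
    then show "adapted_path_metric w \<sigma> xbar y - \<sigma> x y \<le> l" by simp
  qed
  then show ?thesis by simp
qed

lemma abs_dist0_diff: "0 < w x y \<Longrightarrow> \<bar>dist0 x - dist0 y\<bar> \<le> \<sigma> x y"
  using dist0_step[of x y] dist0_step[of y x] sigma_sym[of x y] w_sym[of x y] by auto

lemma dist0_xbar: "dist0 xbar = 0"
proof -
  have "dist0 xbar \<le> path_length \<sigma> [xbar]"
    unfolding dist0_def adapted_path_metric_def
    by (rule cInf_lower[OF _ path_lengths(2)]) (auto simp: is_path_def intro!: exI[of _ "[xbar]"])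
  then show ?thesis using dist0_nonneg[of xbar] by (simp add: path_length_def)
qed

section \<open>Volume growth of balls\<close>

lemma finite_Bl: "finite (Bl r)"
  using finite_ball by (simp add: Bl_def dist0_def)

lemma Bl_mono: "r \<le> r' \<Longrightarrow> Bl r \<subseteq> Bl r'"
  by (auto simp: Bl_def)

lemma vol_mono: "r \<le> r' \<Longrightarrow> vol r \<le> vol r'"
  unfolding vol_def using Bl_mono finite_Bl mu_pos
  by (intro sum_mono2) (auto intro: less_imp_le)

lemma exists_boundary_edge:
  assumes "x \<in> S" "finite S" shows "\<exists>a\<in>S. \<exists>b. b \<notin> S \<and> 0 < w a b"
proof (rule ccontr)
  assume neg: "\<not> ?thesis"
  have "y \<in> S" for y
    using connected[of x y] by (induction rule: rtrancl_induct) (use neg assms in auto)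
  then show False using infinite_UNIV assms(2) by (metis UNIV_eq_I)
qed

text \<open>By connectedness an edge leaves the finite ball, and \<open>\<sigma> \<le> 1\<close>
  puts its outer endpoint into the ball of radius one more. Hence each unit of radius adds a vertex,
  which is the source of the linear volume growth.\<close>

lemma card_Bl_ge: "Suc n \<le> card (Bl (real n))"
proof (induction n)
  case 0
  have "xbar \<in> Bl 0" by (simp add: Bl_def dist0_xbar)
  then show ?case using finite_Bl[of 0] by (simp add: Suc_le_eq card_gt_0_iff) blast
next
  case (Suc n)
  have "xbar \<in> Bl (real n)" by (simp add: Bl_def dist0_xbar)
  then obtain a b where ab: "a \<in> Bl (real n)" "b \<notin> Bl (real n)" "0 < w a b"
    using exists_boundary_edge finite_Bl by blast
  have "b \<in> Bl (real (Suc n))"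
    using dist0_step[OF ab(3)] sigma_le_1[OF ab(3)] ab(1) by (simp add: Bl_def)
  then have "insert b (Bl (real n)) \<subseteq> Bl (real (Suc n))"
    using Bl_mono[of "real n" "real (Suc n)"] by simp
  then have "card (insert b (Bl (real n))) \<le> card (Bl (real (Suc n)))"
    using finite_Bl card_mono by blast
  then show ?case using Suc ab(2) finite_Bl by simp
qed

lemma vol_ge: "0 \<le> r \<Longrightarrow> C0 * r \<le> vol r"
proof -
  assume r: "0 \<le> r"
  define n where "n = nat \<lfloor>r\<rfloor>"
  have n: "real n \<le> r" "r \<le> real (Suc n)" using r by (auto simp: n_def) linarith
  have "C0 * r \<le> C0 * real (card (Bl (real n)))"
    using n(2) card_Bl_ge[of n] C0(1) by (intro mult_left_mono) auto
  also have "\<dots> = (\<Sum>y\<in>Bl (real n). C0)" by simp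
  also have "\<dots> \<le> vol (real n)" unfolding vol_def by (intro sum_mono C0(2))
  also have "\<dots> \<le> vol r" by (rule vol_mono[OF n(1)])
  finally show ?thesis .
qed

lemma ball_measure_eq: "ball_measure \<mu> (adapted_path_metric w \<sigma>) xbar r = ennreal (vol r)"
proof -
  have "ball_measure \<mu> (adapted_path_metric w \<sigma>) xbar r = (\<Sum>y\<in>Bl r. ennreal (\<mu> y))"
    unfolding ball_measure_def dist0_def[symmetric] Bl_def[symmetric]
    by (rule nn_integral_count_space_finite[OF finite_Bl])
  then show ?thesis by (simp add: vol_def mu_pos less_imp_le)
qed

lemma vol_nonneg: "0 \<le> vol r"
  unfolding vol_def by (intro sum_nonneg) (simp add: mu_pos less_imp_le)

lemma inv_log_plus_vol:
  "inv_log_plus (ball_measure \<mu> (adapted_path_metric w \<sigma>) xbar r) a = 1 / (ln (vol r) + a)"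
  by (simp add: ball_measure_eq inv_log_plus_def vol_nonneg)

text \<open>On the metric graph with edges of length \<open>\<sigma>\<close>, eliminating the interior of an edge from
  \<open>h'' = s\<^sup>2 h\<close> leaves the conductance \<open>iw s x y\<close> between its endpoints.\<close>

definition iw :: "real \<Rightarrow> 'v \<Rightarrow> 'v \<Rightarrow> real" where
  "iw s x y = w x y * (s * \<sigma> x y / sinh (s * \<sigma> x y))"

lemma iw_nonneg: "0 < s \<Longrightarrow> 0 \<le> iw s x y"
proof -
  assume s: "0 < s"
  show ?thesis
  proof (cases "0 < w x y")
    case True
    then show ?thesis using s sigma_pos[of x y] by (simp add: iw_def)
  next
    case False
    then show ?thesis using w_nonneg[of x y] by (simp add: iw_def)
  qed
qed

lemma iw_zero: "y \<notin> nbr x \<Longrightarrow> iw s x y = 0"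
  using w_nonneg[of x y] by (simp add: iw_def nbr_def)

text \<open>On an edge, \<open>s * (h y - cosh (s * \<sigma> x y) * h x) / sinh (s * \<sigma> x
  y)\<close> is the slope at \<open>x\<close> of the solution of \<open>h'' = s^2 h\<close> with the
  given end values. The equation thus balances the slopes leaving \<open>x\<close>, weighted by
  \<open>w * \<sigma>\<close>, against the mass \<open>\<mu> x\<close>. Solving it for
  \<open>h x\<close> gives the monotone map \<open>T\<close>. Iteration from the constant 1
  decreases because \<open>cosh \<ge> 1\<close>, and the limit is a fixed point because the sums
  over neighbours are finite.\<close>

lemma dirichlet_solution:
  assumes s: "0 < s"
  obtains h where "\<And>x. 0 \<le> h x" "\<And>x. h x \<le> 1" "\<And>x. x \<notin> B \<Longrightarrow> h x = 1"
    "\<And>x. x \<in> B \<Longrightarrow>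
      (\<Sum>y\<in>nbr x. iw s x y * (h y - cosh (s * \<sigma> x y) * h x)) = s\<^sup>2 * \<mu> x * h x"
proof -
  define D where "D x = s\<^sup>2 * \<mu> x + (\<Sum>y\<in>nbr x. iw s x y * cosh (s * \<sigma> x y))" for x
  define T where "T h x = (if x \<in> B then (\<Sum>y\<in>nbr x. iw s x y * h y) / D x else 1)"
    for h :: "'v \<Rightarrow> real" and x
  define H where "H k = (T ^^ k) (\<lambda>_. 1)" for k
  have D: "0 < D x" for x
    unfolding D_def using s mu_pos iw_nonneg
    by (intro add_pos_nonneg sum_nonneg) (auto simp: zero_less_power)
  have T_mono: "T f x \<le> T g x" if "\<And>y. f y \<le> g y" for f g x
    unfolding T_def using that iw_nonneg[OF s] D[of x]
    by (auto intro!: divide_right_mono sum_mono mult_left_mono)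
  have T_nonneg: "0 \<le> T f x" if "\<And>y. 0 \<le> f y" for f x
    unfolding T_def using that iw_nonneg[OF s] D[of x]
    by (auto intro!: divide_nonneg_pos sum_nonneg)
  have T1: "T (\<lambda>_. 1) x \<le> 1" for x
  proof -
    have "iw s x y * 1 \<le> iw s x y * cosh (s * \<sigma> x y)" for y
      using iw_nonneg[OF s] cosh_real_ge_1 by (intro mult_left_mono)
    then have "(\<Sum>y\<in>nbr x. iw s x y) \<le> (\<Sum>y\<in>nbr x. iw s x y * cosh (s * \<sigma> x y))"
      by (intro sum_mono) simp
    also have "\<dots> \<le> D x" using mu_pos[of x] s by (simp add: D_def)
    finally show ?thesis using D[of x] by (simp add: T_def)
  qed
  have H0: "0 \<le> H k x" for k x
    by (induction k arbitrary: x) (auto simp: H_def intro!: T_nonneg)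
  have HS: "H (Suc k) x = T (H k) x" for k x by (simp add: H_def)
  have Hdec: "H (Suc k) x \<le> H k x" for k x
  proof (induction k arbitrary: x)
    case 0 then show ?case using T1 by (simp add: H_def)
  next
    case (Suc k)
    then show ?case using T_mono[of "H (Suc k)" "H k" x] by (simp only: HS)
  qed
  have "\<exists>l. (\<lambda>k. H k x) \<longlonglongrightarrow> l" for x
    using decseq_convergent[of "\<lambda>k. H k x" 0] Hdec H0 by (auto simp: decseq_Suc_iff) metis
  then obtain h where h: "\<And>x. (\<lambda>k. H k x) \<longlonglongrightarrow> h x" by metis
  have fp: "h x = T h x" for x
  proof -
    have "(\<lambda>k. T (H k) x) \<longlonglongrightarrow> T h x"
      unfolding T_def using D[of x] by (auto intro!: tendsto_intros h)
    moreover have "(\<lambda>k. T (H k) x) \<longlonglongrightarrow> h x"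
      using LIMSEQ_Suc[OF h[of x]] by (simp add: HS)
    ultimately show ?thesis using LIMSEQ_unique by blast
  qed
  show ?thesis
  proof
    show "0 \<le> h x" for x using h H0 by (intro LIMSEQ_le_const[OF h]) auto
    have "H k x \<le> 1" for k x
      by (induction k) (use Hdec[of _ x] order_trans in \<open>fastforce simp: H_def\<close>)+
    then show "h x \<le> 1" for x by (intro LIMSEQ_le_const2[OF h]) auto
    show "h x = 1" if "x \<notin> B" for x using fp[of x] that by (simp add: T_def)
    show "(\<Sum>y\<in>nbr x. iw s x y * (h y - cosh (s * \<sigma> x y) * h x)) = s\<^sup>2 * \<mu> x * h x"
      if "x \<in> B" for x
    proof -
      have "(\<Sum>y\<in>nbr x. iw s x y * h y) = D x * h x"
        using fp[of x] that D[of x] by (simp add: T_def field_simps)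
      then show ?thesis
        by (simp add: D_def algebra_simps sum_subtractf sum_distrib_left)
    qed
  qed
qed

text \<open>The equation is multiplied by \<open>h x * (\<eta> x)\<^sup>2\<close> and summed. The
  cutoff \<eta> vanishes off the ball, so the equation is called upon only inside. Pairing the two
  directions of each edge, \<open>agmon_edge_bound\<close> leaves at most
  \<open>s\<^sup>2 * w * \<sigma>\<^sup>2\<close>, and by the adapted condition these add up to at
  most \<open>s\<^sup>2 * vol R\<close>. It applies because the distance to the outside of the ball
  changes by at most \<sigma> along an edge.\<close>

lemma agmon_estimate:
  assumes s: "0 < s" and h: "\<And>x. 0 \<le> h x" "\<And>x. h x \<le> 1"
    and eq: "\<And>x. x \<in> Bl R \<Longrightarrow>
      (\<Sum>y\<in>nbr x. iw s x y * (h y - cosh (s * \<sigma> x y) * h x)) = s\<^sup>2 * \<mu> x * h x"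
  shows "(\<Sum>x\<in>Bl R. \<mu> x * (h x * (exp (s / 4 * (R - dist0 x)) - 1))\<^sup>2) \<le> vol R"
proof -
  define \<rho> where "\<rho> x = max 0 (R - dist0 x)" for x
  define \<eta> where "\<eta> x = exp (s / 4 * \<rho> x) - 1" for x
  \<comment> \<open>The outer neighbours are included so that rows from the ball are complete while
    the double sum remains symmetric.\<close>
  define S where "S = Bl R \<union> (\<Union>x\<in>Bl R. nbr x)"
  define P where "P x y = iw s x y * (h y - cosh (s * \<sigma> x y) * h x) * (h x * (\<eta> x)\<^sup>2)" for x y
  define Q where "Q x y = s\<^sup>2 * (w x y * (\<sigma> x y)\<^sup>2)" for x y
  \<comment> \<open>The cost of an edge is charged only to its endpoints inside the ball, so the
    total is \<open>vol R\<close> and not the measure of \<open>S\<close>.\<close>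
  define I where "I x = (if x \<in> Bl R then 1 else 0 :: real)" for x
  have S: "finite S" "Bl R \<subseteq> S" using finite_Bl finite_nbr by (auto simp: S_def)
  have \<eta>0: "\<eta> x = 0" if "x \<notin> Bl R" for x using that by (simp add: \<eta>_def \<rho>_def Bl_def)
  have Q0: "0 \<le> Q x y" and Qsym: "Q x y = Q y x" for x y
    using w_nonneg[of x y] w_sym[of x y] sigma_sym[of x y] by (cases "0 < w x y"; auto simp: Q_def)+
  have PQ: "P x y + P y x \<le> Q x y * I x + Q y x * I y" for x y
  proof (cases "0 < w x y \<and> (x \<in> Bl R \<or> y \<in> Bl R)")
    case False
    then show ?thesis using w_nonneg[of x y] w_sym[of x y]
      by (auto simp: P_def Q_def I_def iw_def \<eta>0)
  next
    case True
    define k where "k = s * \<sigma> x y"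
    have k: "0 < k" using True s sigma_pos by (simp add: k_def)
    have syx: "\<sigma> y x = \<sigma> x y" "w y x = w x y" using True sigma_sym w_sym by metis+
    have "\<bar>\<rho> x - \<rho> y\<bar> \<le> \<sigma> x y" using abs_dist0_diff[of x y] True by (auto simp: \<rho>_def)
    then have "s / 4 * \<bar>\<rho> x - \<rho> y\<bar> \<le> k / 4" using s by (simp add: k_def)
    then have bd: "k / sinh k * (h x * h y * ((\<eta> x)\<^sup>2 + (\<eta> y)\<^sup>2)
      - cosh k * ((h x)\<^sup>2 * (\<eta> x)\<^sup>2 + (h y)\<^sup>2 * (\<eta> y)\<^sup>2)) \<le> k\<^sup>2"
      unfolding \<eta>_def using s k h by (intro agmon_edge_bound) (auto simp: \<rho>_def)
    have "P x y + P y x = w x y * (k / sinh k * (h x * h y * ((\<eta> x)\<^sup>2 + (\<eta> y)\<^sup>2)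
      - cosh k * ((h x)\<^sup>2 * (\<eta> x)\<^sup>2 + (h y)\<^sup>2 * (\<eta> y)\<^sup>2)))"
      unfolding P_def iw_def syx k_def[symmetric] by algebra
    also have "\<dots> \<le> w x y * k\<^sup>2" using bd True by (intro mult_left_mono) auto
    also have "\<dots> = Q x y" by (simp add: Q_def k_def power_mult_distrib)
    also have "\<dots> \<le> Q x y * I x + Q y x * I y"
      using True Q0[of x y] Qsym[of x y] by (auto simp: I_def)
    finally show ?thesis .
  qed
  have row: "(\<Sum>y\<in>S. P x y) = s\<^sup>2 * (\<mu> x * (h x * \<eta> x)\<^sup>2)" for x
  proof (cases "x \<in> Bl R")
    case True
    have "(\<Sum>y\<in>S. P x y) = (\<Sum>y\<in>nbr x. P x y)"
      using True S by (intro sum.mono_neutral_right) (auto simp: S_def P_def iw_zero)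
    also have "\<dots> = (\<Sum>y\<in>nbr x. iw s x y * (h y - cosh (s * \<sigma> x y) * h x)) * (h x * (\<eta> x)\<^sup>2)"
      by (simp add: P_def sum_distrib_right)
    finally show ?thesis using eq[OF True] by (simp add: power2_eq_square)
  qed (simp add: P_def \<eta>0)
  have rowQ: "(\<Sum>y\<in>S. Q x y * I x) \<le> s\<^sup>2 * (\<mu> x * I x)" for x
  proof (cases "x \<in> Bl R")
    case True
    have "(\<Sum>y\<in>S. Q x y * I x) = (\<Sum>y\<in>nbr x. Q x y)"
      using True S w_nonneg[of x] by (intro sum.mono_neutral_cong_right)
        (auto simp: S_def Q_def nbr_def I_def not_less intro: antisym)
    also have "\<dots> = s\<^sup>2 * (\<Sum>y\<in>nbr x. w x y * (\<sigma> x y)\<^sup>2)" by (simp add: Q_def sum_distrib_left)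
    also have "\<dots> \<le> s\<^sup>2 * \<mu> x" using adapted_sum by (intro mult_left_mono) auto
    finally show ?thesis using True by (simp add: I_def)
  qed (simp add: I_def)
  have sym: "(\<Sum>x\<in>S. \<Sum>y\<in>S. f x y + f y x) = 2 * (\<Sum>x\<in>S. \<Sum>y\<in>S. f x y)" for f :: "'v \<Rightarrow> 'v \<Rightarrow> real"
    using sum.swap[of "\<lambda>x y. f y x" S S] by (simp add: sum.distrib)
  have "2 * (\<Sum>x\<in>S. \<Sum>y\<in>S. P x y) = (\<Sum>x\<in>S. \<Sum>y\<in>S. P x y + P y x)" by (simp only: sym)
  also have "\<dots> \<le> (\<Sum>x\<in>S. \<Sum>y\<in>S. Q x y * I x + Q y x * I y)"
    by (intro sum_mono PQ)
  also have "\<dots> = 2 * (\<Sum>x\<in>S. \<Sum>y\<in>S. Q x y * I x)" by (rule sym)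
  finally have "(\<Sum>x\<in>S. \<Sum>y\<in>S. P x y) \<le> (\<Sum>x\<in>S. \<Sum>y\<in>S. Q x y * I x)" by simp
  also have "\<dots> \<le> (\<Sum>x\<in>S. s\<^sup>2 * (\<mu> x * I x))" by (intro sum_mono rowQ)
  also have "\<dots> = s\<^sup>2 * (\<Sum>x\<in>S. \<mu> x * I x)" by (simp add: sum_distrib_left)
  also have "(\<Sum>x\<in>S. \<mu> x * I x) = vol R"
    unfolding vol_def using S by (intro sum.mono_neutral_cong_right) (auto simp: I_def)
  finally have "s\<^sup>2 * (\<Sum>x\<in>S. \<mu> x * (h x * \<eta> x)\<^sup>2) \<le> s\<^sup>2 * vol R"
    by (simp add: row sum_distrib_left)
  then have "(\<Sum>x\<in>S. \<mu> x * (h x * \<eta> x)\<^sup>2) \<le> vol R" using s by simp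
  moreover have "(\<Sum>x\<in>S. \<mu> x * (h x * \<eta> x)\<^sup>2)
      = (\<Sum>x\<in>Bl R. \<mu> x * (h x * (exp (s / 4 * (R - dist0 x)) - 1))\<^sup>2)"
    using S by (intro sum.mono_neutral_cong_right) (auto simp: \<eta>0, auto simp: \<eta>_def \<rho>_def Bl_def)
  ultimately show ?thesis by simp
qed

text \<open>The edge bound, applied to \<open>E = H y / H x\<close>, is multiplied by
  \<open>w x y\<close> and summed over the neighbours. The supersolution inequality for
  \<open>H\<close> contributes \<open>\<theta> * s\<^sup>2 * \<mu> x\<close>, the quadratic errors
  contribute three times as much by the adapted condition, hence the 4. The bound
  \<open>\<theta> * s \<le> 1 / 2\<close> suffices for all edges since
  \<open>\<sigma> \<le> 1\<close>.\<close>

lemma powr_supersolution: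
  assumes s: "0 < s" and \<theta>: "0 < \<theta>" "\<theta> \<le> 1 / 4" "\<theta> * s \<le> 1 / 2" and H: "\<And>y. 0 < H y"
    and sup: "(\<Sum>y\<in>nbr x. iw s x y * (H y - cosh (s * \<sigma> x y) * H x)) \<le> s\<^sup>2 * \<mu> x * H x"
  shows "(\<Sum>y\<in>nbr x. w x y * H y powr \<theta>) \<le> (wdeg w x + 4 * \<theta> * s\<^sup>2 * \<mu> x) * H x powr \<theta>"
proof -
  have pw: "w x y * ((H y / H x) powr \<theta> - 1)
      \<le> \<theta> / H x * (iw s x y * (H y - cosh (s * \<sigma> x y) * H x)) + 3 * \<theta> * s\<^sup>2 * (w x y * (\<sigma> x y)\<^sup>2)"
    if "y \<in> nbr x" for y
  proof -
    define k where "k = s * \<sigma> x y"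
    have y: "0 < w x y" using that by (simp add: nbr_def)
    have k: "0 < k" using y s sigma_pos by (simp add: k_def)
    have "\<theta> * k \<le> \<theta> * s" using sigma_le_1[OF y] s \<theta> by (simp add: k_def)
    then have "\<theta> * k \<le> 1 / 2" using \<theta> by linarith
    then have "(H y / H x) powr \<theta> - 1 \<le> \<theta> * (k / sinh k * (H y / H x - cosh k)) + 3 * \<theta> * k\<^sup>2"
      using k \<theta> H by (intro power_transform_edge_bound) auto
    then have "w x y * ((H y / H x) powr \<theta> - 1)
        \<le> w x y * (\<theta> * (k / sinh k * (H y / H x - cosh k)) + 3 * \<theta> * k\<^sup>2)"
      using y by (intro mult_left_mono) auto
    also have "H y / H x - cosh k = (H y - cosh k * H x) / H x" using H[of x] by (simp add: field_simps)
    also have "w x y * (\<theta> * (k / sinh k * ((H y - cosh k * H x) / H x)) + 3 * \<theta> * k\<^sup>2)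
      = \<theta> / H x * (w x y * (k / sinh k) * (H y - cosh k * H x)) + 3 * \<theta> * (w x y * k\<^sup>2)"
      by (simp add: distrib_left mult_ac)
    finally show ?thesis by (simp add: iw_def k_def power_mult_distrib mult_ac)
  qed
  have "(\<Sum>y\<in>nbr x. w x y * ((H y / H x) powr \<theta> - 1))
      \<le> (\<Sum>y\<in>nbr x. \<theta> / H x * (iw s x y * (H y - cosh (s * \<sigma> x y) * H x))
          + 3 * \<theta> * s\<^sup>2 * (w x y * (\<sigma> x y)\<^sup>2))"
    by (intro sum_mono pw)
  also have "\<dots> = \<theta> / H x * (\<Sum>y\<in>nbr x. iw s x y * (H y - cosh (s * \<sigma> x y) * H x))
      + 3 * \<theta> * s\<^sup>2 * (\<Sum>y\<in>nbr x. w x y * (\<sigma> x y)\<^sup>2)"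
    by (simp add: sum.distrib sum_distrib_left)
  also have "\<dots> \<le> \<theta> / H x * (s\<^sup>2 * \<mu> x * H x) + 3 * \<theta> * s\<^sup>2 * \<mu> x"
    using sup adapted_sum[of x] \<theta> H[of x] by (intro add_mono mult_left_mono) auto
  also have "\<dots> = 4 * \<theta> * s\<^sup>2 * \<mu> x" using H[of x] by (simp add: field_simps)
  finally have "(\<Sum>y\<in>nbr x. w x y * ((H y / H x) powr \<theta> - 1)) \<le> 4 * \<theta> * s\<^sup>2 * \<mu> x" .
  moreover have "(\<Sum>y\<in>nbr x. w x y * ((H y / H x) powr \<theta> - 1))
      = (\<Sum>y\<in>nbr x. w x y * H y powr \<theta>) / H x powr \<theta> - wdeg w x"
  proof -
    have "w x y * ((H y / H x) powr \<theta> - 1) = w x y * H y powr \<theta> / H x powr \<theta> - w x y" for y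
      using H[of x] H[of y] by (simp add: powr_divide right_diff_distrib)
    then show ?thesis by (simp add: wdeg_eq sum_subtractf sum_divide_distrib)
  qed
  ultimately have "(\<Sum>y\<in>nbr x. w x y * H y powr \<theta>) / H x powr \<theta> \<le> wdeg w x + 4 * \<theta> * s\<^sup>2 * \<mu> x"
    by simp
  then show ?thesis using H[of x] by (simp add: pos_divide_le_eq)
qed

text \<open>\<open>g\<close> is the power \<theta> of the Dirichlet solution raised by a constant.
  At a single point of the inner ball the Agmon sum dominates one summand, and
  \<open>\<mu> x \<ge> C0\<close> turns this into a pointwise bound;
  \<open>16 / C0 \<le> vol R\<close> absorbs the constants. The two terms of the minimum defining
  \<theta> are the two constraints of the edge bound.\<close>

lemma exit_supersolution:
  fixes R :: real
  defines "L \<equiv> ln (vol R)"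
  defines "s \<equiv> 16 * L / R"
  defines "\<theta> \<equiv> min (1 / 4) (1 / (2 * s))"
  assumes R: "0 < R" and V: "2 \<le> vol R" "16 / C0 \<le> vol R"
  obtains g where "\<And>x. 0 < g x" "\<And>x. x \<notin> Bl R \<Longrightarrow> 1 \<le> g x"
    "\<And>x. x \<in> Bl R \<Longrightarrow> (\<Sum>y\<in>nbr x. w x y * g y) \<le> (wdeg w x + 4 * \<theta> * s\<^sup>2 * \<mu> x) * g x"
    "\<And>x. dist0 x \<le> R / 2 \<Longrightarrow> g x \<le> exp (- \<theta> * L)"
proof -
  define V where "V = vol R"
  have V: "2 \<le> V" "16 / C0 \<le> V" using V by (auto simp: V_def)
  have L: "0 < L" using V by (simp add: L_def V_def[symmetric])
  have s: "0 < s" using L R by (simp add: s_def)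
  have \<theta>: "0 < \<theta>" "\<theta> \<le> 1 / 4" using s by (auto simp: \<theta>_def)
  have "\<theta> \<le> 1 / (2 * s)" by (simp add: \<theta>_def)
  then have \<theta>s: "\<theta> * s \<le> 1 / 2" using s by (simp add: field_simps)
  obtain h where h: "\<And>x. 0 \<le> h x" "\<And>x. h x \<le> 1" "\<And>x. x \<notin> Bl R \<Longrightarrow> h x = 1"
    and eq: "\<And>x. x \<in> Bl R \<Longrightarrow>
      (\<Sum>y\<in>nbr x. iw s x y * (h y - cosh (s * \<sigma> x y) * h x)) = s\<^sup>2 * \<mu> x * h x"
    using dirichlet_solution[OF s, of "Bl R"] by blast
  \<comment> \<open>The added constant makes the base of the power positive. It preserves the
    supersolution inequality, again by \<open>cosh \<ge> 1\<close>, and equals the bound proved for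
    \<open>h\<close> near the centre.\<close>
  define H where "H x = h x + 1 / (2 * V)" for x
  have H: "0 < H x" for x using h(1)[of x] V by (simp add: H_def add_nonneg_pos)
  have small: "H x \<le> 1 / V" if x: "dist0 x \<le> R / 2" for x
  proof -
    have xB: "x \<in> Bl R" using x R by (simp add: Bl_def)
    \<comment> \<open>Origin of the 16 in \<open>s\<close>: up to radius \<open>R / 2\<close> the
      exponential weight reaches \<open>V\<^sup>2\<close>.\<close>
    have "2 * L = s / 4 * (R / 2)" using R by (simp add: s_def)
    also have "\<dots> \<le> s / 4 * (R - dist0 x)" using x s by (intro mult_left_mono) auto
    finally have "exp (2 * L) \<le> exp (s / 4 * (R - dist0 x))" by simp
    moreover have "exp (2 * L) = V\<^sup>2"
      using V by (simp add: L_def V_def[symmetric] exp_double)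
    moreover have "2 \<le> V\<^sup>2" using power_mono[OF V(1), of 2] by simp
    ultimately have "V\<^sup>2 / 2 \<le> exp (s / 4 * (R - dist0 x)) - 1" by linarith
    then have "h x * (V\<^sup>2 / 2) \<le> h x * (exp (s / 4 * (R - dist0 x)) - 1)"
      using h(1) by (intro mult_left_mono)
    then have "(h x * (V\<^sup>2 / 2))\<^sup>2 \<le> (h x * (exp (s / 4 * (R - dist0 x)) - 1))\<^sup>2"
      using h(1) by (intro power_mono) auto
    then have "C0 * (h x * (V\<^sup>2 / 2))\<^sup>2 \<le> \<mu> x * (h x * (exp (s / 4 * (R - dist0 x)) - 1))\<^sup>2"
      using C0 by (intro mult_mono) (auto intro: order_trans less_imp_le)
    also have "\<dots> \<le> (\<Sum>x\<in>Bl R. \<mu> x * (h x * (exp (s / 4 * (R - dist0 x)) - 1))\<^sup>2)"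
      by (rule member_le_sum[OF xB _ finite_Bl]) (simp add: mu_pos less_imp_le)
    also have "\<dots> \<le> V" using agmon_estimate[OF s h(1,2) eq] by (simp add: V_def)
    finally have 1: "C0 * (h x * (V\<^sup>2 / 2))\<^sup>2 \<le> V" .
    have "16 \<le> C0 * V" using V(2) C0(1) by (simp add: field_simps)
    then have "16 * (h x * (V\<^sup>2 / 2))\<^sup>2 \<le> C0 * V * (h x * (V\<^sup>2 / 2))\<^sup>2"
      by (intro mult_right_mono) auto
    also have "\<dots> = V * (C0 * (h x * (V\<^sup>2 / 2))\<^sup>2)" by simp
    also have "\<dots> \<le> V * V" using 1 V(1) by (intro mult_left_mono) auto
    finally have "(2 * (h x * V) * V)\<^sup>2 \<le> V\<^sup>2" by (simp add: power2_eq_square mult_ac)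
    then have "2 * (h x * V) * V \<le> V" using V(1) by (simp add: abs_le_square_iff[symmetric] h(1))
    then have "h x \<le> 1 / (2 * V)" using V(1) by (simp add: field_simps)
    then show ?thesis by (simp add: H_def)
  qed
  show ?thesis
  proof
    show "0 < H x powr \<theta>" for x using H[of x] by simp
    show "1 \<le> H x powr \<theta>" if "x \<notin> Bl R" for x
      using h(3)[OF that] V \<theta> by (intro ge_one_powr_ge_zero) (auto simp: H_def)
    show "(\<Sum>y\<in>nbr x. w x y * H y powr \<theta>) \<le> (wdeg w x + 4 * \<theta> * s\<^sup>2 * \<mu> x) * H x powr \<theta>"
      if x: "x \<in> Bl R" for x
    proof (rule powr_supersolution[OF s \<theta> \<theta>s H])
      have "(\<Sum>y\<in>nbr x. iw s x y * (H y - cosh (s * \<sigma> x y) * H x))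
          \<le> (\<Sum>y\<in>nbr x. iw s x y * (h y - cosh (s * \<sigma> x y) * h x))"
      proof (intro sum_mono mult_left_mono iw_nonneg[OF s])
        fix y
        have "1 * (1 / (2 * V)) \<le> cosh (s * \<sigma> x y) * (1 / (2 * V))"
          using cosh_real_ge_1[of "s * \<sigma> x y"] V(1) by (intro mult_right_mono) auto
        then show "H y - cosh (s * \<sigma> x y) * H x \<le> h y - cosh (s * \<sigma> x y) * h x"
          by (simp add: H_def distrib_left)
      qed
      also have "\<dots> = s\<^sup>2 * \<mu> x * h x" by (rule eq[OF x])
      also have "\<dots> \<le> s\<^sup>2 * \<mu> x * H x"
        using V mu_pos[of x] by (intro mult_left_mono) (auto simp: H_def)
      finally show "(\<Sum>y\<in>nbr x. iw s x y * (H y - cosh (s * \<sigma> x y) * H x)) \<le> s\<^sup>2 * \<mu> x * H x" .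
    qed
    show "H x powr \<theta> \<le> exp (- \<theta> * L)" if "dist0 x \<le> R / 2" for x
    proof -
      have "H x powr \<theta> \<le> (1 / V) powr \<theta>"
        using small[OF that] H[of x] \<theta> by (intro powr_mono2) auto
      also have "\<dots> = exp (- \<theta> * L)" using V by (simp add: powr_def L_def V_def[symmetric] ln_div)
      finally show ?thesis .
    qed
  qed
qed

end

section \<open>Laplace functionals of the jump chain\<close>

text \<open>Writing \<open>exp (- b x)\<close> as 1 minus the integral of
  \<open>b * exp (- b t)\<close> over \<open>0 \<le> t < x\<close> and exchanging integrals turns
  exponential tails into a Laplace transform. The factor \<open>f\<close> carries all other
  coordinates. Tails are given for \<open>t \<ge> 0\<close> only, hence the restriction to
  \<open>0 < X\<close>, whose \<open>f\<close>-mass is \<open>K\<close>.\<close>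

lemma nn_integral_exp_from_tails:
  fixes f :: "'a \<Rightarrow> ennreal" and X :: "'a \<Rightarrow> real" and b K :: real
  assumes M: "sigma_finite_measure M"
    and f [measurable]: "f \<in> borel_measurable M" and X [measurable]: "X \<in> borel_measurable M"
    and K: "0 \<le> K" and b: "0 \<le> b"
    and tail: "\<And>t. 0 \<le> t \<Longrightarrow> (\<integral>\<^sup>+\<omega>. f \<omega> * of_bool (t < X \<omega>) \<partial>M) = ennreal (K * exp (- t))"
  shows "(\<integral>\<^sup>+\<omega>. f \<omega> * (of_bool (0 < X \<omega>) * ennreal (exp (- b * X \<omega>))) \<partial>M) = ennreal (K / (1 + b))"
    (is "?A = _")
proof -
  interpret M: sigma_finite_measure M by (rule M)
  interpret P: pair_sigma_finite M lborel ..
  define g where "g t = ennreal (b * exp (- b * t)) * indicator {0..} t" for t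
  have [measurable]: "g \<in> borel_measurable borel" by (simp add: g_def[abs_def])
  have inner: "(\<integral>\<^sup>+t. g t * of_bool (t < x) \<partial>lborel) = ennreal (1 - exp (- b * x))" if "0 < x" for x
  proof -
    have "(\<integral>\<^sup>+t. g t * of_bool (t < x) \<partial>lborel)
        = (\<integral>\<^sup>+t. ennreal (b * exp (- b * t)) * indicator {0..x} t \<partial>lborel)"
      by (rule nn_integral_cong_AE, use AE_lborel_singleton[of x] in eventually_elim)
         (auto simp: g_def indicator_def)
    also have "\<dots> = ennreal ((- exp (- b * x)) - (- exp (- b * 0)))"
    proof (rule nn_integral_FTC_Icc)
      show "((\<lambda>t. - exp (- b * t)) has_real_derivative b * exp (- b * t)) (at t)" for t
        by (auto intro!: derivative_eq_intros)
    qed (use b that in auto)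
    finally show ?thesis by simp
  qed
  have fsplit: "f \<omega> * (of_bool (0 < X \<omega>) * ennreal (exp (- b * X \<omega>)))
      + (\<integral>\<^sup>+t. f \<omega> * (g t * of_bool (t < X \<omega>)) \<partial>lborel) = f \<omega> * of_bool (0 < X \<omega>)" for \<omega>
  proof (cases "0 < X \<omega>")
    case True
    have "0 \<le> b * X \<omega>" using True b by simp
    then have "ennreal (exp (- b * X \<omega>)) + ennreal (1 - exp (- b * X \<omega>)) = 1"
      by (simp flip: ennreal_plus)
    then show ?thesis using True
      by (simp add: nn_integral_cmult inner flip: distrib_left)
  next
    case False
    then have "(\<integral>\<^sup>+t. f \<omega> * (g t * of_bool (t < X \<omega>)) \<partial>lborel) = (\<integral>\<^sup>+t. 0 \<partial>(lborel :: real measure))"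
      by (intro nn_integral_cong) (auto simp: g_def indicator_def)
    then show ?thesis using False by simp
  qed
  have "(\<integral>\<^sup>+\<omega>. \<integral>\<^sup>+t. f \<omega> * (g t * of_bool (t < X \<omega>)) \<partial>lborel \<partial>M)
      = (\<integral>\<^sup>+t. \<integral>\<^sup>+\<omega>. f \<omega> * (g t * of_bool (t < X \<omega>)) \<partial>M \<partial>lborel)"
    by (rule P.Fubini'[symmetric]) measurable
  also have "\<dots> = (\<integral>\<^sup>+t. ennreal (K * b * exp (- (1 + b) * t)) * indicator {0..} t \<partial>lborel)"
  proof (rule nn_integral_cong)
    fix t :: real
    have "(\<integral>\<^sup>+\<omega>. f \<omega> * (g t * of_bool (t < X \<omega>)) \<partial>M) = g t * (\<integral>\<^sup>+\<omega>. f \<omega> * of_bool (t < X \<omega>) \<partial>M)"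
      by (subst nn_integral_cmult[symmetric]) (auto simp: mult_ac)
    also have "\<dots> = ennreal (K * b * exp (- (1 + b) * t)) * indicator {0..} t"
    proof (cases "0 \<le> t")
      case True
      have "b * exp (- b * t) * (K * exp (- t)) = K * b * exp (- (1 + b) * t)"
        by (simp add: mult_exp_exp algebra_simps)
      then show ?thesis using True b K by (simp add: g_def tail flip: ennreal_mult)
    qed (simp add: g_def)
    finally show "(\<integral>\<^sup>+\<omega>. f \<omega> * (g t * of_bool (t < X \<omega>)) \<partial>M)
      = ennreal (K * b * exp (- (1 + b) * t)) * indicator {0..} t" .
  qed
  also have "\<dots> = ennreal (0 - (- (K * b / (1 + b)) * exp (- (1 + b) * 0)))"
  proof (rule nn_integral_FTC_atLeast)
    show "((\<lambda>t. - (K * b / (1 + b)) * exp (- (1 + b) * t)) has_real_derivative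
        K * b * exp (- (1 + b) * t)) (at t)" for t
    proof -
      have "((\<lambda>t. - c * exp (- (1 + b) * t)) has_real_derivative c * (1 + b) * exp (- (1 + b) * t)) (at t)" for c
        by (auto intro!: derivative_eq_intros simp: algebra_simps)
      from this[of "K * b / (1 + b)"] show ?thesis using b by simp
    qed
    have "((\<lambda>t. exp (- (1 + b) * t)) \<longlongrightarrow> 0) at_top"
    proof (rule filterlim_compose[OF exp_at_bot])
      show "LIM t at_top. - (1 + b) * t :> at_bot"
        using b by (intro filterlim_tendsto_neg_mult_at_bot[OF tendsto_const]) (auto simp: filterlim_ident)
    qed
    then show "((\<lambda>t. - (K * b / (1 + b)) * exp (- (1 + b) * t)) \<longlongrightarrow> 0) at_top"
      by (rule tendsto_mult_right_zero)
  qed (use b K in auto)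
  finally have B: "(\<integral>\<^sup>+\<omega>. \<integral>\<^sup>+t. f \<omega> * (g t * of_bool (t < X \<omega>)) \<partial>lborel \<partial>M) = ennreal (K * b / (1 + b))"
    by simp
  have "?A + (\<integral>\<^sup>+\<omega>. \<integral>\<^sup>+t. f \<omega> * (g t * of_bool (t < X \<omega>)) \<partial>lborel \<partial>M)
      = (\<integral>\<^sup>+\<omega>. f \<omega> * of_bool (0 < X \<omega>) \<partial>M)"
    by (subst nn_integral_add[symmetric]) (measurable, simp only: fsplit)
  also have "\<dots> = ennreal K" using tail[of 0] by simp
  finally have "?A + ennreal (K * b / (1 + b)) = ennreal K" by (simp add: B)
  then have "?A = ennreal K - ennreal (K * b / (1 + b))"
    using ennreal_add_diff_cancel_right[of "ennreal (K * b / (1 + b))" ?A] by simp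
  also have "\<dots> = ennreal (K - K * b / (1 + b))" using b K by (intro ennreal_minus) auto
  also have "K - K * b / (1 + b) = K / (1 + b)" using b by (simp add: field_simps)
  finally show ?thesis .
qed

lemma nn_integral_countable_partition:
  fixes X :: "'a \<Rightarrow> 'b::countable"
  assumes [measurable]: "f \<in> borel_measurable M" "X \<in> measurable M (count_space UNIV)"
  shows "(\<integral>\<^sup>+\<omega>. f \<omega> * G (X \<omega>) \<partial>M)
    = (\<integral>\<^sup>+x. G x * (\<integral>\<^sup>+\<omega>. f \<omega> * of_bool (X \<omega> = x) \<partial>M) \<partial>count_space UNIV)"
proof -
  have "f \<omega> * G (X \<omega>) = (\<integral>\<^sup>+x. G x * (f \<omega> * of_bool (X \<omega> = x)) \<partial>count_space UNIV)" for \<omega>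
    by (subst nn_integral_count_space'[of "{X \<omega>}"]) (auto simp: mult.commute)
  then have "(\<integral>\<^sup>+\<omega>. f \<omega> * G (X \<omega>) \<partial>M)
      = (\<integral>\<^sup>+\<omega>. \<integral>\<^sup>+x. G x * (f \<omega> * of_bool (X \<omega> = x)) \<partial>count_space UNIV \<partial>M)" by simp
  also have "\<dots> = (\<integral>\<^sup>+x. \<integral>\<^sup>+\<omega>. G x * (f \<omega> * of_bool (X \<omega> = x)) \<partial>M \<partial>count_space UNIV)"
    by (rule nn_integral_count_space_nn_integral) auto
  also have "\<dots> = (\<integral>\<^sup>+x. G x * (\<integral>\<^sup>+\<omega>. f \<omega> * of_bool (X \<omega> = x) \<partial>M) \<partial>count_space UNIV)"
    by (intro nn_integral_cong nn_integral_cmult) measurable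
  finally show ?thesis .
qed

text \<open>The starting point \<open>x0\<close> is separate from the centre \<open>xbar\<close> of
  the balls: conservativeness concerns every start, while the volume hypothesis is about balls
  around \<open>xbar\<close>.\<close>

locale adapted_chain = adapted_graph +
  fixes x0 :: 'a and M :: "'w measure" and Y :: "nat \<Rightarrow> 'w \<Rightarrow> 'a" and E :: "nat \<Rightarrow> 'w \<Rightarrow> real"
  assumes chain: "minimal_chain w \<mu> x0 M Y E"
begin

sublocale prob_space M
  using chain by (simp add: minimal_chain_def)

lemma Y_measurable [measurable]: "Y n \<in> measurable M (count_space UNIV)"
  and E_measurable [measurable]: "E n \<in> borel_measurable M"
  using chain by (auto simp: minimal_chain_def)

section \<open>Discounted law of finite histories\<close>

lemma path_measure:
  assumes "\<And>i. i \<le> n \<Longrightarrow> 0 \<le> ts i"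
  shows "prob {\<omega> \<in> space M. \<forall>i\<le>n. Y i \<omega> = xs i \<and> ts i < E i \<omega>}
    = of_bool (xs 0 = x0) * (\<Prod>i<n. jump_prob w (xs i) (xs (Suc i))) * (\<Prod>i\<le>n. exp (- ts i))"
  using chain assms unfolding minimal_chain_def of_bool_def by blast

definition path_prob :: "nat \<Rightarrow> (nat \<Rightarrow> 'a) \<Rightarrow> real" where
  "path_prob n xs = of_bool (xs 0 = x0) * (\<Prod>i<n. jump_prob w (xs i) (xs (Suc i)))"

lemma path_prob_nonneg: "0 \<le> path_prob n xs"
  unfolding path_prob_def by (intro mult_nonneg_nonneg prod_nonneg) (auto simp: jump_prob_nonneg)

text \<open>The law of the chain is given by joint tails of the exponential variables. The induction
  replaces one tail indicator at a time by a Laplace factor; at the end none is left.\<close>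

lemma path_laplace_tails:
  assumes b: "\<And>i. 0 \<le> b i" and ts: "\<And>i. 0 \<le> ts i" and "k \<le> Suc n"
  shows "(\<integral>\<^sup>+\<omega>. of_bool (\<forall>i\<le>n. Y i \<omega> = xs i)
      * (\<Prod>i<k. of_bool (0 < E i \<omega>) * ennreal (exp (- b i * E i \<omega>)))
      * (\<Prod>i\<in>{k..n}. of_bool (ts i < E i \<omega>)) \<partial>M)
    = ennreal (path_prob n xs * (\<Prod>i<k. 1 / (1 + b i)) * (\<Prod>i\<in>{k..n}. exp (- ts i)))"
  using ts \<open>k \<le> Suc n\<close>
proof (induction k arbitrary: ts)
  case 0
  have "of_bool (\<forall>i\<le>n. Y i \<omega> = xs i) * (\<Prod>i\<in>{0..n}. of_bool (ts i < E i \<omega>))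
      = (indicator {\<omega> \<in> space M. \<forall>i\<le>n. Y i \<omega> = xs i \<and> ts i < E i \<omega>} \<omega> :: ennreal)"
    if "\<omega> \<in> space M" for \<omega>
  proof (cases "\<forall>i\<le>n. ts i < E i \<omega>")
    case True
    then show ?thesis using that by (auto simp: indicator_def)
  next
    case False
    then have "(\<Prod>i\<in>{0..n}. of_bool (ts i < E i \<omega>)) = (0 :: ennreal)"
      by (intro prod_zero) auto
    then show ?thesis using False by (auto simp: indicator_def)
  qed
  then have "(\<integral>\<^sup>+\<omega>. of_bool (\<forall>i\<le>n. Y i \<omega> = xs i) * (\<Prod>i\<in>{0..n}. of_bool (ts i < E i \<omega>)) \<partial>M)
      = (\<integral>\<^sup>+\<omega>. indicator {\<omega> \<in> space M. \<forall>i\<le>n. Y i \<omega> = xs i \<and> ts i < E i \<omega>} \<omega> \<partial>M)"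
    by (rule nn_integral_cong)
  also have "\<dots> = emeasure M {\<omega> \<in> space M. \<forall>i\<le>n. Y i \<omega> = xs i \<and> ts i < E i \<omega>}"
    by (rule nn_integral_indicator) measurable
  finally have "(\<integral>\<^sup>+\<omega>. of_bool (\<forall>i\<le>n. Y i \<omega> = xs i) * (\<Prod>i\<in>{0..n}. of_bool (ts i < E i \<omega>)) \<partial>M)
      = emeasure M {\<omega> \<in> space M. \<forall>i\<le>n. Y i \<omega> = xs i \<and> ts i < E i \<omega>}" .
  then show ?case using path_measure[of n ts xs] 0
    by (simp add: emeasure_eq_measure path_prob_def atMost_atLeast0)
next
  case (Suc k)
  define F where "F \<omega> = of_bool (\<forall>i\<le>n. Y i \<omega> = xs i)
      * (\<Prod>i<k. of_bool (0 < E i \<omega>) * ennreal (exp (- b i * E i \<omega>)))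
      * (\<Prod>i\<in>{Suc k..n}. of_bool (ts i < E i \<omega>) :: ennreal)" for \<omega>
  define K where "K = path_prob n xs * (\<Prod>i<k. 1 / (1 + b i)) * (\<Prod>i\<in>{Suc k..n}. exp (- ts i))"
  have kn: "k \<le> n" using Suc.prems by simp
  have K: "0 \<le> K" unfolding K_def using b path_prob_nonneg
    by (intro mult_nonneg_nonneg prod_nonneg) auto
  have [measurable]: "F \<in> borel_measurable M" unfolding F_def by measurable
  have "(\<integral>\<^sup>+\<omega>. F \<omega> * (of_bool (0 < E k \<omega>) * ennreal (exp (- b k * E k \<omega>))) \<partial>M)
      = ennreal (K / (1 + b k))"
  proof (rule nn_integral_exp_from_tails[OF _ _ _ K b])
    show "sigma_finite_measure M" ..
    fix t :: real assume t: "0 \<le> t"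
    have int: "{k..n} = insert k {Suc k..n}" using kn by auto
    \<comment> \<open>Varying only the level in coordinate \<open>k\<close>, the induction
      hypothesis supplies the tails of \<open>E k\<close> weighted by \<open>F\<close>.\<close>
    define ts' where "ts' = ts(k := t)"
    have "(\<Prod>i\<in>{Suc k..n}. of_bool (ts' i < E i \<omega>)) = (\<Prod>i\<in>{Suc k..n}. of_bool (ts i < E i \<omega>) :: ennreal)" for \<omega>
      by (intro prod.cong) (auto simp: ts'_def)
    moreover have "(\<Prod>i\<in>{Suc k..n}. exp (- ts' i)) = (\<Prod>i\<in>{Suc k..n}. exp (- ts i))"
      by (intro prod.cong) (auto simp: ts'_def)
    moreover have "0 \<le> ts' i" for i using Suc.prems t by (simp add: ts'_def)
    moreover have "ts' k = t" by (simp add: ts'_def)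
    ultimately show "(\<integral>\<^sup>+\<omega>. F \<omega> * of_bool (t < E k \<omega>) \<partial>M) = ennreal (K * exp (- t))"
      using Suc.IH[of ts'] kn unfolding int F_def K_def by (simp add: mult_ac)
  qed measurable
  moreover have "F \<omega> * (of_bool (0 < E k \<omega>) * ennreal (exp (- b k * E k \<omega>)))
      = of_bool (\<forall>i\<le>n. Y i \<omega> = xs i)
      * (\<Prod>i<Suc k. of_bool (0 < E i \<omega>) * ennreal (exp (- b i * E i \<omega>)))
      * (\<Prod>i\<in>{Suc k..n}. of_bool (ts i < E i \<omega>))" for \<omega>
    by (simp only: F_def prod.lessThan_Suc mult_ac)
  moreover have "K / (1 + b k)
      = path_prob n xs * (\<Prod>i<Suc k. 1 / (1 + b i)) * (\<Prod>i\<in>{Suc k..n}. exp (- ts i))"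
    by (simp add: K_def)
  ultimately show ?case by simp
qed

text \<open>Histories are lists over a countable type, so integrals split into sums over them, and
  discounts and test functions may depend on the whole past.\<close>

definition hist :: "nat \<Rightarrow> 'w \<Rightarrow> 'a list" where
  "hist n \<omega> = map (\<lambda>i. Y i \<omega>) [0..<Suc n]"

lemma length_hist [simp]: "length (hist n \<omega>) = Suc n"
  by (simp add: hist_def)

lemma hist_nonempty [simp]: "hist n \<omega> \<noteq> []"
  by (simp add: hist_def)

lemma last_hist [simp]: "last (hist n \<omega>) = Y n \<omega>"
  by (simp add: hist_def)

lemma hist_Suc: "hist (Suc n) \<omega> = hist n \<omega> @ [Y (Suc n) \<omega>]"
  by (simp add: hist_def)

lemma set_hist: "set (hist n \<omega>) = (\<lambda>i. Y i \<omega>) ` {..n}"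
  by (auto simp: hist_def less_Suc_eq_le simp del: upt_Suc)

lemma hist_eq_iff: "hist n \<omega> = xs \<longleftrightarrow> length xs = Suc n \<and> (\<forall>i\<le>n. Y i \<omega> = xs ! i)"
proof
  assume "length xs = Suc n \<and> (\<forall>i\<le>n. Y i \<omega> = xs ! i)"
  then show "hist n \<omega> = xs"
    by (intro nth_equalityI) (auto simp: hist_def less_Suc_eq_le simp del: upt_Suc)
qed (auto simp: hist_def less_Suc_eq_le simp del: upt_Suc)

lemma take_hist: "i \<le> n \<Longrightarrow> take (Suc i) (hist n \<omega>) = hist i \<omega>"
  by (simp add: hist_def take_map del: upt_Suc)

lemma hist_measurable [measurable]: "hist n \<in> measurable M (count_space UNIV)"
proof (subst measurable_count_space_eq2_countable, safe)
  fix xs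
  have "hist n -` {xs} \<inter> space M = {\<omega> \<in> space M. length xs = Suc n \<and> (\<forall>i\<le>n. Y i \<omega> = xs ! i)}"
    using hist_eq_iff[of n _ xs] by blast
  also have "\<dots> \<in> sets M" by measurable
  finally show "hist n -` {xs} \<inter> space M \<in> sets M" .
qed auto

text \<open>The holding variable of the current state is not yet discounted. Its factor
  \<open>0 < E n\<close> is kept because the finite-dimensional law for \<open>Y 0\<close>, ...,
  \<open>Y n\<close> also involves \<open>E n\<close>.\<close>

definition laplace_weight :: "('a list \<Rightarrow> real) \<Rightarrow> nat \<Rightarrow> 'w \<Rightarrow> ennreal" where
  "laplace_weight b n \<omega> = (\<Prod>i<n. of_bool (0 < E i \<omega>) * ennreal (exp (- b (hist i \<omega>) * E i \<omega>)))
      * of_bool (0 < E n \<omega>)"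

lemma laplace_weight_measurable [measurable]: "laplace_weight b n \<in> borel_measurable M"
  unfolding laplace_weight_def by measurable

lemma laplace_weight_path:
  assumes b: "\<And>xs. 0 \<le> b xs"
  shows "(\<integral>\<^sup>+\<omega>. laplace_weight b n \<omega> * of_bool (hist n \<omega> = xs) \<partial>M)
    = of_bool (length xs = Suc n) * ennreal (path_prob n ((!) xs) * (\<Prod>i<n. 1 / (1 + b (take (Suc i) xs))))"
proof (cases "length xs = Suc n")
  case True
  define b' where "b' i = (if i < n then b (take (Suc i) xs) else 0)" for i
  have "laplace_weight b n \<omega> * of_bool (hist n \<omega> = xs) = of_bool (\<forall>i\<le>n. Y i \<omega> = xs ! i)
      * (\<Prod>i<Suc n. of_bool (0 < E i \<omega>) * ennreal (exp (- b' i * E i \<omega>)))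
      * (\<Prod>i\<in>{Suc n..n}. of_bool (0 < E i \<omega>))" for \<omega>
  proof (cases "hist n \<omega> = xs")
    case eq: True
    then have "hist i \<omega> = take (Suc i) xs" if "i < n" for i using take_hist[of i n \<omega>] that by simp
    then have "laplace_weight b n \<omega>
        = (\<Prod>i<n. of_bool (0 < E i \<omega>) * ennreal (exp (- b' i * E i \<omega>))) * of_bool (0 < E n \<omega>)"
      unfolding laplace_weight_def b'_def by (intro arg_cong2[of _ _ _ _ "(*)"] prod.cong) auto
    moreover have "\<forall>i\<le>n. Y i \<omega> = xs ! i" using eq by (simp add: hist_eq_iff)
    ultimately show ?thesis using eq by (simp add: b'_def)
  next
    case False
    then have "\<not> (\<forall>i\<le>n. Y i \<omega> = xs ! i)" using True by (simp add: hist_eq_iff)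
    then show ?thesis using False by simp
  qed
  then have "(\<integral>\<^sup>+\<omega>. laplace_weight b n \<omega> * of_bool (hist n \<omega> = xs) \<partial>M)
      = ennreal (path_prob n ((!) xs) * (\<Prod>i<Suc n. 1 / (1 + b' i)) * (\<Prod>i\<in>{Suc n..n}. exp (- 0)))"
    using path_laplace_tails[of b' "\<lambda>_. 0" "Suc n" n "(!) xs"] b by (simp add: b'_def)
  also have "(\<Prod>i<Suc n. 1 / (1 + b' i)) = (\<Prod>i<n. 1 / (1 + b (take (Suc i) xs)))"
    by (simp add: b'_def)
  finally show ?thesis using True by simp
next
  case False
  then have "hist n \<omega> \<noteq> xs" for \<omega> by (simp add: hist_eq_iff)
  then show ?thesis using False by simp
qed

lemma laplace_weight_path_snoc:
  assumes b: "\<And>xs. 0 \<le> b xs"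
  shows "(\<integral>\<^sup>+\<omega>. laplace_weight b (Suc n) \<omega> * of_bool (hist (Suc n) \<omega> = xs @ [y]) \<partial>M)
    = ennreal (jump_prob w (last xs) y / (1 + b xs))
      * (\<integral>\<^sup>+\<omega>. laplace_weight b n \<omega> * of_bool (hist n \<omega> = xs) \<partial>M)"
proof (cases "length xs = Suc n")
  case True
  then have ne: "xs \<noteq> []" by auto
  have "path_prob (Suc n) ((!) (xs @ [y])) = path_prob n ((!) xs) * jump_prob w (last xs) y"
  proof -
    have "(\<Prod>i<n. jump_prob w ((xs @ [y]) ! i) ((xs @ [y]) ! Suc i))
        = (\<Prod>i<n. jump_prob w (xs ! i) (xs ! Suc i))"
      using True by (intro prod.cong) (auto simp: nth_append)
    moreover have "last xs = xs ! n" using True ne by (simp add: last_conv_nth)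
    ultimately show ?thesis using True by (simp add: path_prob_def nth_append)
  qed
  moreover have "(\<Prod>i<Suc n. 1 / (1 + b (take (Suc i) (xs @ [y]))))
      = (\<Prod>i<n. 1 / (1 + b (take (Suc i) xs))) * (1 / (1 + b xs))"
    using True by simp
  moreover have "0 \<le> path_prob n ((!) xs) * (\<Prod>i<n. 1 / (1 + b (take (Suc i) xs)))"
    using b path_prob_nonneg by (intro mult_nonneg_nonneg prod_nonneg) auto
  moreover have "0 \<le> jump_prob w (last xs) y / (1 + b xs)"
    using b[of xs] jump_prob_nonneg by simp
  ultimately have "ennreal (path_prob (Suc n) ((!) (xs @ [y])) * (\<Prod>i<Suc n. 1 / (1 + b (take (Suc i) (xs @ [y])))))
      = ennreal (jump_prob w (last xs) y / (1 + b xs))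
        * ennreal (path_prob n ((!) xs) * (\<Prod>i<n. 1 / (1 + b (take (Suc i) xs))))"
    by (simp only: ennreal_mult[symmetric]) (simp add: mult_ac)
  then show ?thesis using True
    by (simp only: laplace_weight_path[OF b]) simp
qed (simp add: laplace_weight_path[OF b])

text \<open>The Markov property in integrated form: appending \<open>y\<close> to a history
  multiplies its weight by the jump probability times \<open>1 / (1 + b)\<close>, the Laplace
  transform of an Exp(1) variable at \<open>b\<close>.\<close>

lemma laplace_weight_step:
  assumes b: "\<And>xs. 0 \<le> b xs"
  shows "(\<integral>\<^sup>+\<omega>. laplace_weight b (Suc n) \<omega> * G (hist (Suc n) \<omega>) \<partial>M)
    = (\<integral>\<^sup>+\<omega>. laplace_weight b n \<omega> * (\<Sum>y\<in>nbr (Y n \<omega>).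
        ennreal (jump_prob w (Y n \<omega>) y / (1 + b (hist n \<omega>))) * G (hist n \<omega> @ [y])) \<partial>M)"
proof -
  let ?W = "\<lambda>xs. \<integral>\<^sup>+\<omega>. laplace_weight b n \<omega> * of_bool (hist n \<omega> = xs) \<partial>M"
  let ?p = "\<lambda>xs y. ennreal (jump_prob w (last xs) y / (1 + b xs))"
  have "(\<integral>\<^sup>+\<omega>. laplace_weight b (Suc n) \<omega> * G (hist (Suc n) \<omega>) \<partial>M)
      = (\<integral>\<^sup>+\<omega>. laplace_weight b (Suc n) \<omega> * (\<lambda>(xs, y). G (xs @ [y])) (hist n \<omega>, Y (Suc n) \<omega>) \<partial>M)"
    by (simp add: hist_Suc)
  also have "\<dots> = (\<integral>\<^sup>+z. (\<lambda>(xs, y). G (xs @ [y])) z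
      * (\<integral>\<^sup>+\<omega>. laplace_weight b (Suc n) \<omega> * of_bool ((hist n \<omega>, Y (Suc n) \<omega>) = z) \<partial>M) \<partial>count_space UNIV)"
    by (rule nn_integral_countable_partition) measurable
  also have "\<dots> = (\<integral>\<^sup>+xs. \<integral>\<^sup>+y. G (xs @ [y])
      * (\<integral>\<^sup>+\<omega>. laplace_weight b (Suc n) \<omega> * of_bool ((hist n \<omega>, Y (Suc n) \<omega>) = (xs, y)) \<partial>M)
        \<partial>count_space UNIV \<partial>count_space UNIV)"
    by (subst nn_integral_fst_count_space[symmetric]) simp
  also have "\<dots> = (\<integral>\<^sup>+xs. \<integral>\<^sup>+y. G (xs @ [y]) * (?p xs y * ?W xs) \<partial>count_space UNIV \<partial>count_space UNIV)"
  proof -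
    have "(\<integral>\<^sup>+\<omega>. laplace_weight b (Suc n) \<omega> * of_bool ((hist n \<omega>, Y (Suc n) \<omega>) = (xs, y)) \<partial>M)
        = ?p xs y * ?W xs" for xs y
      using laplace_weight_path_snoc[OF b, where xs = xs and y = y and n = n] by (simp add: hist_Suc)
    then show ?thesis by simp
  qed
  also have "\<dots> = (\<integral>\<^sup>+xs. (\<Sum>y\<in>nbr (last xs). ?p xs y * G (xs @ [y])) * ?W xs \<partial>count_space UNIV)"
  proof (rule nn_integral_cong)
    fix xs
    have "(\<integral>\<^sup>+y. G (xs @ [y]) * (?p xs y * ?W xs) \<partial>count_space UNIV)
        = (\<Sum>y\<in>nbr (last xs). G (xs @ [y]) * (?p xs y * ?W xs))"
      by (rule nn_integral_count_space'[OF finite_nbr]) (auto simp: jump_prob_zero)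
    also have "\<dots> = (\<Sum>y\<in>nbr (last xs). ?p xs y * G (xs @ [y])) * ?W xs"
      unfolding sum_distrib_right by (intro sum.cong refl) (simp only: mult_ac)
    finally show "(\<integral>\<^sup>+y. G (xs @ [y]) * (?p xs y * ?W xs) \<partial>count_space UNIV)
        = (\<Sum>y\<in>nbr (last xs). ?p xs y * G (xs @ [y])) * ?W xs" .
  qed
  also have "\<dots> = (\<integral>\<^sup>+\<omega>. laplace_weight b n \<omega> *
      (\<lambda>xs. \<Sum>y\<in>nbr (last xs). ?p xs y * G (xs @ [y])) (hist n \<omega>) \<partial>M)"
    by (rule nn_integral_countable_partition[symmetric]) measurable
  finally show ?thesis by simp
qed

lemma laplace_weight_0:
  assumes b: "\<And>xs. 0 \<le> b xs"
  shows "(\<integral>\<^sup>+\<omega>. laplace_weight b 0 \<omega> * G (hist 0 \<omega>) \<partial>M) = G [x0]"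
proof -
  have "(\<integral>\<^sup>+\<omega>. laplace_weight b 0 \<omega> * G (hist 0 \<omega>) \<partial>M)
      = (\<integral>\<^sup>+xs. G xs * (\<integral>\<^sup>+\<omega>. laplace_weight b 0 \<omega> * of_bool (hist 0 \<omega> = xs) \<partial>M) \<partial>count_space UNIV)"
    by (rule nn_integral_countable_partition) measurable
  also have "\<dots> = (\<Sum>xs\<in>{[x0]}. G xs * (\<integral>\<^sup>+\<omega>. laplace_weight b 0 \<omega> * of_bool (hist 0 \<omega> = xs) \<partial>M))"
    by (rule nn_integral_count_space')
       (auto simp: laplace_weight_path[OF b] path_prob_def length_Suc_conv)
  also have "\<dots> = G [x0]" by (simp add: laplace_weight_path[OF b] path_prob_def)
  finally show ?thesis .
qed

text \<open>For \<open>b = \<alpha> / jump_rate w \<mu> x\<close> one has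
  \<open>1 + b = (wdeg w x + \<alpha> * \<mu> x) / wdeg w x\<close>, so the hypothesis
  \<open>sup\<close> is the form that supersolutions of rate \<alpha> satisfy along the jump
  chain.\<close>

lemma laplace_supermartingale:
  assumes b: "\<And>xs. 0 \<le> b xs" and G: "\<And>xs. 0 \<le> G xs"
    and sup: "\<And>xs. xs \<noteq> [] \<Longrightarrow> (\<Sum>y\<in>nbr (last xs). jump_prob w (last xs) y * G (xs @ [y])) \<le> (1 + b xs) * G xs"
  shows "(\<integral>\<^sup>+\<omega>. laplace_weight b n \<omega> * ennreal (G (hist n \<omega>)) \<partial>M) \<le> ennreal (G [x0])"
proof (induction n)
  case 0
  show ?case using laplace_weight_0[OF b, where G = "\<lambda>xs. ennreal (G xs)"] by simp
next
  case (Suc n)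
  have *: "(\<Sum>y\<in>nbr (Y n \<omega>). ennreal (jump_prob w (Y n \<omega>) y / (1 + b (hist n \<omega>))) * ennreal (G (hist n \<omega> @ [y])))
      \<le> ennreal (G (hist n \<omega>))" for \<omega>
  proof -
    let ?xs = "hist n \<omega>"
    have b0: "0 < 1 + b ?xs" using b[of ?xs] by simp
    have "(\<Sum>y\<in>nbr (Y n \<omega>). ennreal (jump_prob w (Y n \<omega>) y / (1 + b ?xs)) * ennreal (G (?xs @ [y])))
        = (\<Sum>y\<in>nbr (Y n \<omega>). ennreal (jump_prob w (Y n \<omega>) y / (1 + b ?xs) * G (?xs @ [y])))"
      using G b0 jump_prob_nonneg by (intro sum.cong refl ennreal_mult[symmetric]) auto
    also have "\<dots> = ennreal (\<Sum>y\<in>nbr (Y n \<omega>). jump_prob w (Y n \<omega>) y / (1 + b ?xs) * G (?xs @ [y]))"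
      using G b0 jump_prob_nonneg by (intro sum_ennreal) auto
    also have "\<dots> = ennreal ((\<Sum>y\<in>nbr (Y n \<omega>). jump_prob w (Y n \<omega>) y * G (?xs @ [y])) / (1 + b ?xs))"
      by (simp add: sum_divide_distrib)
    also have "\<dots> \<le> ennreal (G ?xs)"
      using sup[of ?xs] b0 by (intro ennreal_leI) (simp add: pos_divide_le_eq mult.commute)
    finally show ?thesis .
  qed
  have "(\<integral>\<^sup>+\<omega>. laplace_weight b (Suc n) \<omega> * ennreal (G (hist (Suc n) \<omega>)) \<partial>M)
      \<le> (\<integral>\<^sup>+\<omega>. laplace_weight b n \<omega> * ennreal (G (hist n \<omega>)) \<partial>M)"
    unfolding laplace_weight_step[OF b, where n = n and G = "\<lambda>xs. ennreal (G xs)"]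
    by (intro nn_integral_mono mult_left_mono *) simp
  then show ?case using Suc by simp
qed

text \<open>Without discount the weight has total mass 1, because jump probabilities sum to 1, and
  it is at most the indicator of \<open>0 < E n\<close>.\<close>

lemma AE_E_pos: "AE \<omega> in M. \<forall>n. 0 < E n \<omega>"
proof -
  have one: "(\<integral>\<^sup>+\<omega>. laplace_weight (\<lambda>_. 0) n \<omega> \<partial>M) = 1" for n
  proof (induction n)
    case 0
    show ?case using laplace_weight_0[of "\<lambda>_. 0" "\<lambda>_. 1"] by simp
  next
    case (Suc n)
    have "(\<Sum>y\<in>nbr x. ennreal (jump_prob w x y)) = 1" for x
      using sum_ennreal[of "nbr x" "jump_prob w x"] jump_prob_nonneg sum_jump_prob by simp
    then show ?case using laplace_weight_step[of "\<lambda>_. 0" n "\<lambda>_. 1"] Suc by simp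
  qed
  have "AE \<omega> in M. 0 < E n \<omega>" for n
  proof -
    have "laplace_weight (\<lambda>_. 0) n \<omega> \<le> indicator {\<omega> \<in> space M. 0 < E n \<omega>} \<omega>" if "\<omega> \<in> space M" for \<omega>
    proof -
      have "(\<Prod>i<n. of_bool (0 < E i \<omega>) * ennreal (exp (- 0 * E i \<omega>))) \<le> 1"
        by (intro prod_le_1) auto
      then show ?thesis using that by (auto simp: laplace_weight_def indicator_def)
    qed
    then have "(\<integral>\<^sup>+\<omega>. laplace_weight (\<lambda>_. 0) n \<omega> \<partial>M)
        \<le> (\<integral>\<^sup>+\<omega>. indicator {\<omega> \<in> space M. 0 < E n \<omega>} \<omega> \<partial>M)"
      by (rule nn_integral_mono)
    then have "1 \<le> emeasure M {\<omega> \<in> space M. 0 < E n \<omega>}"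
      by (simp add: one)
    then have "prob {\<omega> \<in> space M. 0 < E n \<omega>} = 1"
      by (intro antisym prob_le_1) (simp add: emeasure_eq_measure)
    then show ?thesis by (subst (asm) prob_eq_1) auto
  qed
  then show ?thesis by (simp add: AE_all_countable)
qed

section \<open>Passage between two concentric balls\<close>

definition holding :: "nat \<Rightarrow> 'w \<Rightarrow> real" where
  "holding i \<omega> = E i \<omega> / jump_rate w \<mu> (Y i \<omega>)"

lemma jump_time_eq: "jump_time w \<mu> Y E n \<omega> = (\<Sum>i<n. holding i \<omega>)"
  by (simp add: jump_time_def holding_def)

lemma holding_measurable [measurable]: "holding i \<in> borel_measurable M"
proof -
  have [measurable]: "(\<lambda>x. jump_rate w \<mu> x) \<in> borel_measurable (count_space UNIV)" by simp
  show ?thesis unfolding holding_def[abs_def] by measurable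
qed

lemma holding_pos: "0 < E i \<omega> \<Longrightarrow> 0 < holding i \<omega>"
  by (simp add: holding_def jump_rate_pos)

text \<open>The summand selects the time elapsed between the exit from \<open>Bl r\<close> and the exit from \<open>Bl R\<close>.\<close>

definition exits_fast :: "real \<Rightarrow> real \<Rightarrow> real \<Rightarrow> nat \<Rightarrow> 'w \<Rightarrow> bool" where
  "exits_fast r R t k \<omega> \<longleftrightarrow> Y k \<omega> \<notin> Bl R \<and> (\<forall>i<k. Y i \<omega> \<in> Bl R) \<and>
     (\<Sum>i<k. if \<exists>j\<le>i. Y j \<omega> \<notin> Bl r then holding i \<omega> else 0) \<le> t"

lemma exits_fast_measurable [measurable]: "Measurable.pred M (exits_fast r R t k)"
  unfolding exits_fast_def[abs_def] by measurable

text \<open>One function \<open>G\<close> on histories covers three phases: \<gamma> before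
  \<open>Bl r\<close> is left, then \<open>g\<close> at the current vertex, then 1 once
  \<open>Bl R\<close> is left; time is discounted in the middle phase only. On the event, after
  \<open>n\<close> jumps \<open>G\<close> is 1 and the weight is at least
  \<open>exp (- \<alpha> * t)\<close>, so the supermartingale bound with initial value \<gamma>
  gives the estimate as in Markov's inequality.\<close>

lemma prob_exits_fast_upto:
  fixes r R t :: real
  defines "L \<equiv> ln (vol R)"
  defines "s \<equiv> 16 * L / R"
  defines "\<theta> \<equiv> min (1 / 4) (1 / (2 * s))"
  assumes R: "0 < R" "r + 1 \<le> R / 2" and V: "2 \<le> vol R" "16 / C0 \<le> vol R"
    and x0: "x0 \<in> Bl r"
  shows "prob {\<omega> \<in> space M. \<exists>k\<le>n. exits_fast r R t k \<omega>} \<le> exp (4 * \<theta> * s\<^sup>2 * t - \<theta> * L)"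
proof -
  define \<alpha> where "\<alpha> = 4 * \<theta> * s\<^sup>2"
  define \<gamma> where "\<gamma> = exp (- \<theta> * L)"
  have L: "0 < L" using V by (simp add: L_def)
  have s: "0 < s" using L R by (simp add: s_def)
  have \<theta>: "0 < \<theta>" using s by (simp add: \<theta>_def)
  have \<alpha>: "0 \<le> \<alpha>" using \<theta> by (simp add: \<alpha>_def)
  obtain g where g: "\<And>x. 0 < g x" "\<And>x. x \<notin> Bl R \<Longrightarrow> 1 \<le> g x"
    and g_sup: "\<And>x. x \<in> Bl R \<Longrightarrow> (\<Sum>y\<in>nbr x. w x y * g y) \<le> (wdeg w x + \<alpha> * \<mu> x) * g x"
    and g_small: "\<And>x. dist0 x \<le> R / 2 \<Longrightarrow> g x \<le> \<gamma>"
    using exit_supersolution[OF R(1) V] unfolding \<alpha>_def \<gamma>_def L_def s_def \<theta>_def by blast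
  have rR: "Bl r \<subseteq> Bl R" using R by (intro Bl_mono) simp
  define out where "out q xs \<longleftrightarrow> (\<exists>x\<in>set xs. x \<notin> Bl q)" for q xs
  define b where "b xs = (if out R xs \<or> \<not> out r xs then 0 else \<alpha> / jump_rate w \<mu> (last xs))" for xs
  define G where "G xs = (if out R xs then 1 else if out r xs then g (last xs) else \<gamma>)" for xs
  have b0: "0 \<le> b xs" for xs using \<alpha> jump_rate_pos[of "last xs"] by (simp add: b_def)
  have G0: "0 \<le> G xs" for xs using g(1)[of "last xs"] by (simp add: G_def \<gamma>_def)
  have sup: "(\<Sum>y\<in>nbr (last xs). jump_prob w (last xs) y * G (xs @ [y])) \<le> (1 + b xs) * G xs"
    if "xs \<noteq> []" for xs
  proof -
    have out_snoc: "out q (xs @ [y]) \<longleftrightarrow> out q xs \<or> y \<notin> Bl q" for q y by (auto simp: out_def)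
    consider "out R xs" | "\<not> out R xs" "out r xs" | "\<not> out R xs" "\<not> out r xs" by blast
    then show ?thesis
    proof cases
      case 1
      then show ?thesis by (simp add: G_def b_def out_snoc sum_jump_prob)
    next
      case 2
      have x: "last xs \<in> Bl R" using 2 that by (auto simp: out_def)
      have "(\<Sum>y\<in>nbr (last xs). jump_prob w (last xs) y * G (xs @ [y]))
          \<le> (\<Sum>y\<in>nbr (last xs). jump_prob w (last xs) y * g y)"
        using 2 g by (intro sum_mono mult_left_mono jump_prob_nonneg) (auto simp: G_def out_snoc)
      also have "\<dots> = (\<Sum>y\<in>nbr (last xs). w (last xs) y * g y) / wdeg w (last xs)"
        by (simp add: jump_prob_def sum_divide_distrib)
      also have "\<dots> \<le> (wdeg w (last xs) + \<alpha> * \<mu> (last xs)) * g (last xs) / wdeg w (last xs)"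
        using g_sup[OF x] wdeg_pos[of "last xs"] by (intro divide_right_mono) auto
      also have "\<dots> = (1 + b xs) * G xs"
        using 2 wdeg_pos[of "last xs"] mu_pos[of "last xs"]
        by (simp add: b_def G_def jump_rate_def field_simps)
      finally show ?thesis .
    next
      case 3
      have x: "last xs \<in> Bl r" using 3 that by (auto simp: out_def)
      have "G (xs @ [y]) \<le> \<gamma>" if y: "y \<in> nbr (last xs)" for y
      proof (cases "y \<in> Bl r")
        case True
        then show ?thesis using 3 rR by (auto simp: G_def out_snoc)
      next
        case False
        have "0 < w (last xs) y" using y by (simp add: nbr_def)
        \<comment> \<open>A jump moves by at most 1, so the first vertex outside \<open>Bl r\<close>
          still lies where \<open>g \<le> \<gamma>\<close>.\<close>
        then have "dist0 y \<le> R / 2"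
          using dist0_step[of "last xs" y] sigma_le_1[of "last xs" y] x R by (simp add: Bl_def)
        then have "y \<in> Bl R" "g y \<le> \<gamma>" using g_small R by (auto simp: Bl_def)
        then show ?thesis using False 3 by (simp add: G_def out_snoc)
      qed
      then have "(\<Sum>y\<in>nbr (last xs). jump_prob w (last xs) y * G (xs @ [y]))
          \<le> (\<Sum>y\<in>nbr (last xs). jump_prob w (last xs) y * \<gamma>)"
        by (intro sum_mono mult_left_mono jump_prob_nonneg) auto
      also have "\<dots> = \<gamma>" by (simp add: sum_jump_prob flip: sum_distrib_right)
      finally show ?thesis using 3 by (simp add: G_def b_def)
    qed
  qed
  have "G [x0] = \<gamma>" using x0 rR by (auto simp: G_def out_def)
  then have bound: "(\<integral>\<^sup>+\<omega>. laplace_weight b n \<omega> * ennreal (G (hist n \<omega>)) \<partial>M) \<le> ennreal \<gamma>"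
    using laplace_supermartingale[OF b0 G0 sup, of n] by simp
  define A where "A = {\<omega> \<in> space M. \<exists>k\<le>n. exits_fast r R t k \<omega>}"
  have A [measurable]: "A \<in> sets M" unfolding A_def by measurable
  have "AE \<omega> in M. ennreal (exp (- \<alpha> * t)) * indicator A \<omega> \<le> laplace_weight b n \<omega> * ennreal (G (hist n \<omega>))"
    using AE_E_pos
  proof eventually_elim
    case (elim \<omega>)
    show ?case
    proof (cases "\<omega> \<in> A")
      case True
      then obtain k where k: "k \<le> n" "exits_fast r R t k \<omega>" by (auto simp: A_def)
      have outR: "out R (hist i \<omega>) \<longleftrightarrow> k \<le> i" for i
        using k(2) unfolding out_def set_hist exits_fast_def
        by (auto simp: not_le) (meson le_less_trans not_le)
      have be: "b (hist i \<omega>) * E i \<omega>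
          = (if i < k then \<alpha> * (if \<exists>j\<le>i. Y j \<omega> \<notin> Bl r then holding i \<omega> else 0) else 0)" for i
        unfolding b_def outR by (auto simp: out_def set_hist holding_def)
      have "laplace_weight b n \<omega> = ennreal (exp (- (\<Sum>i<n. b (hist i \<omega>) * E i \<omega>)))"
        using elim by (simp add: laplace_weight_def prod_ennreal exp_sum sum_negf[symmetric])
      also have "(\<Sum>i<n. b (hist i \<omega>) * E i \<omega>)
          = \<alpha> * (\<Sum>i<k. if \<exists>j\<le>i. Y j \<omega> \<notin> Bl r then holding i \<omega> else 0)"
        unfolding sum_distrib_left using k(1)
        by (intro sum.mono_neutral_cong_right) (auto simp: be)
      also have "ennreal (exp (- (\<alpha> * (\<Sum>i<k. if \<exists>j\<le>i. Y j \<omega> \<notin> Bl r then holding i \<omega> else 0))))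
          \<ge> ennreal (exp (- \<alpha> * t))"
        using k(2) \<alpha> unfolding exits_fast_def by (intro ennreal_leI) (simp add: mult_left_mono)
      finally have "ennreal (exp (- \<alpha> * t)) \<le> laplace_weight b n \<omega>" .
      moreover have "G (hist n \<omega>) = 1" using outR[of n] k(1) by (simp add: G_def)
      ultimately show ?thesis using True by simp
    qed simp
  qed
  then have "(\<integral>\<^sup>+\<omega>. ennreal (exp (- \<alpha> * t)) * indicator A \<omega> \<partial>M) \<le> ennreal \<gamma>"
    by (rule order_trans[OF nn_integral_mono_AE bound])
  then have "ennreal (exp (- \<alpha> * t) * prob A) \<le> ennreal \<gamma>"
    by (simp add: nn_integral_cmult_indicator emeasure_eq_measure ennreal_mult)
  then have "exp (- \<alpha> * t) * prob A \<le> \<gamma>" by (simp add: \<gamma>_def)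
  then have "prob A \<le> \<gamma> * exp (\<alpha> * t)" by (simp add: exp_minus field_simps)
  also have "\<dots> = exp (\<alpha> * t - \<theta> * L)" by (simp add: \<gamma>_def mult_exp_exp)
  finally show ?thesis by (simp add: A_def \<alpha>_def)
qed

lemma prob_exits_fast:
  fixes r R t :: real
  defines "L \<equiv> ln (vol R)"
  defines "s \<equiv> 16 * L / R"
  defines "\<theta> \<equiv> min (1 / 4) (1 / (2 * s))"
  assumes R: "0 < R" "r + 1 \<le> R / 2" and V: "2 \<le> vol R" "16 / C0 \<le> vol R"
    and x0: "x0 \<in> Bl r"
  shows "prob {\<omega> \<in> space M. \<exists>k. exits_fast r R t k \<omega>} \<le> exp (4 * \<theta> * s\<^sup>2 * t - \<theta> * L)"
proof -
  define A where "A n = {\<omega> \<in> space M. \<exists>k\<le>n. exits_fast r R t k \<omega>}" for n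
  have "(\<lambda>n. prob (A n)) \<longlonglongrightarrow> prob (\<Union>n. A n)"
    by (rule finite_Lim_measure_incseq) (auto simp: A_def incseq_def intro: le_trans)
  then have "prob (\<Union>n. A n) \<le> exp (4 * \<theta> * s\<^sup>2 * t - \<theta> * L)"
    using prob_exits_fast_upto[OF R V x0] unfolding L_def s_def \<theta>_def A_def
    by (intro LIMSEQ_le_const2) auto
  moreover have "(\<Union>n. A n) = {\<omega> \<in> space M. \<exists>k. exits_fast r R t k \<omega>}" by (auto simp: A_def)
  ultimately show ?thesis by simp
qed

text \<open>With discount 1 every jump halves the weight, and \<open>2 ^ length\<close> compensates.
  Hence \<open>exp (- S)\<close>, for \<open>S\<close> the sum of the first \<open>n\<close>
  variables, has expectation at most \<open>(1 / 2) ^ n\<close>; these are summable, so the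
  exponentials almost surely tend to 0.\<close>

lemma AE_sum_E_unbounded: "AE \<omega> in M. \<forall>C. \<exists>n. C < (\<Sum>i<n. E i \<omega>)"
proof -
  let ?W = "laplace_weight (\<lambda>_. 1)"
  have half: "(\<integral>\<^sup>+\<omega>. ?W n \<omega> \<partial>M) \<le> ennreal ((1 / 2) ^ n)" for n
  proof -
    have "(\<integral>\<^sup>+\<omega>. ?W n \<omega> * ennreal (2 ^ length (hist n \<omega>)) \<partial>M) \<le> ennreal (2 ^ length [x0])"
    proof (rule laplace_supermartingale)
      show "(\<Sum>y\<in>nbr (last xs). jump_prob w (last xs) y * 2 ^ length (xs @ [y])) \<le> (1 + 1) * 2 ^ length xs" for xs
        by (simp add: sum_jump_prob flip: sum_distrib_right)
    qed auto
    then have "(\<integral>\<^sup>+\<omega>. ?W n \<omega> \<partial>M) * ennreal (2 ^ Suc n) \<le> ennreal 2"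
      by (simp add: nn_integral_multc)
    then have "(\<integral>\<^sup>+\<omega>. ?W n \<omega> \<partial>M) * ennreal (2 ^ Suc n) * ennreal (1 / 2 ^ Suc n)
        \<le> ennreal 2 * ennreal (1 / 2 ^ Suc n)" by (rule mult_right_mono) simp
    moreover have "ennreal (2 ^ Suc n) * ennreal (1 / 2 ^ Suc n) = 1"
      by (subst ennreal_mult[symmetric]) auto
    moreover have "ennreal 2 * ennreal (1 / 2 ^ Suc n) = ennreal ((1 / 2) ^ n)"
      by (subst ennreal_mult[symmetric]) (auto simp: power_divide)
    ultimately show ?thesis by (simp only: mult.assoc mult_1_right)
  qed
  have "(\<integral>\<^sup>+\<omega>. (\<Sum>n. ?W n \<omega>) \<partial>M) = (\<Sum>n. \<integral>\<^sup>+\<omega>. ?W n \<omega> \<partial>M)"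
    by (rule nn_integral_suminf) measurable
  also have "\<dots> \<le> (\<Sum>n. ennreal ((1 / 2) ^ n))" by (intro suminf_le half) auto
  also have "\<dots> = ennreal (\<Sum>n. (1 / 2) ^ n)" by (intro suminf_ennreal2) auto
  finally have "(\<integral>\<^sup>+\<omega>. (\<Sum>n. ?W n \<omega>) \<partial>M) \<noteq> \<infinity>"
    by (metis ennreal_neq_top infinity_ennreal_def neq_top_trans)
  then have "AE \<omega> in M. (\<Sum>n. ?W n \<omega>) \<noteq> \<infinity>" by (intro nn_integral_PInf_AE) auto
  with AE_E_pos show ?thesis
  proof eventually_elim
    case (elim \<omega>)
    have "?W n \<omega> = ennreal (exp (- (\<Sum>i<n. E i \<omega>)))" for n
      using elim by (simp add: laplace_weight_def prod_ennreal exp_sum sum_negf[symmetric])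
    then have "summable (\<lambda>n. exp (- (\<Sum>i<n. E i \<omega>)))"
      using elim by (intro summable_suminf_not_top) auto
    then have lim: "(\<lambda>n. exp (- (\<Sum>i<n. E i \<omega>))) \<longlonglongrightarrow> 0" by (rule summable_LIMSEQ_zero)
    show ?case
    proof
      fix C :: real
      have "eventually (\<lambda>n. exp (- (\<Sum>i<n. E i \<omega>)) < exp (- C)) sequentially"
        by (rule order_tendstoD(2)[OF lim]) simp
      then show "\<exists>n. C < (\<Sum>i<n. E i \<omega>)"
        by (auto simp: eventually_sequentially)
    qed
  qed
qed

lemma jump_time_mono:
  assumes "\<And>n. 0 < E n \<omega>" "k \<le> l"
  shows "jump_time w \<mu> Y E k \<omega> \<le> jump_time w \<mu> Y E l \<omega>"
  unfolding jump_time_eq using assms holding_pos less_imp_le by (intro sum_mono2) (auto intro: less_imp_le)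

text \<open>Induction over the scales, with \<open>ex n\<close> the first index outside
  \<open>Bl (\<rho> n)\<close>. Slowness bounds the holding time accumulated from
  \<open>ex n\<close> up to \<open>ex (Suc n)\<close> below by \<open>\<tau> n\<close>; the time
  before \<open>ex N\<close> is only counted as nonnegative.\<close>

lemma jump_time_exit_ge:
  fixes \<rho> \<tau> :: "nat \<Rightarrow> real"
  assumes pos: "\<And>n. 0 < E n \<omega>" and \<rho>: "incseq \<rho>" and "N \<le> n"
    and slow: "\<And>j k. N \<le> j \<Longrightarrow> \<not> exits_fast (\<rho> j) (\<rho> (Suc j)) (\<tau> j) k \<omega>"
    and out: "Y k \<omega> \<notin> Bl (\<rho> n)"
  shows "(\<Sum>j\<in>{N..<n}. \<tau> j) \<le> jump_time w \<mu> Y E k \<omega>"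
proof -
  define ex where "ex n = (LEAST k. Y k \<omega> \<notin> Bl (\<rho> n))" for n
  have "(\<Sum>j\<in>{N..<n}. \<tau> j) \<le> jump_time w \<mu> Y E (ex n) \<omega>"
    if "Y k \<omega> \<notin> Bl (\<rho> n)" for k
    using \<open>N \<le> n\<close> that
  proof (induction n arbitrary: k rule: dec_induct)
    case base
    show ?case using jump_time_mono[OF pos, of 0 "ex N"] by (simp add: jump_time_eq)
  next
    case (step n)
    have sub: "Bl (\<rho> n) \<subseteq> Bl (\<rho> (Suc n))" using \<rho> by (intro Bl_mono) (simp add: incseq_SucD)
    have exS: "Y (ex (Suc n)) \<omega> \<notin> Bl (\<rho> (Suc n))"
      unfolding ex_def by (rule LeastI[of _ k]) (rule step.prems)
    have inS: "Y i \<omega> \<in> Bl (\<rho> (Suc n))" if "i < ex (Suc n)" for i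
      using not_less_Least[OF that[unfolded ex_def]] by simp
    have exn: "Y (ex n) \<omega> \<notin> Bl (\<rho> n)"
      unfolding ex_def[of n] by (rule LeastI[of _ "ex (Suc n)"]) (use exS sub in blast)
    have inn: "Y i \<omega> \<in> Bl (\<rho> n)" if "i < ex n" for i
      using not_less_Least[OF that[unfolded ex_def]] by simp
    have le: "ex n \<le> ex (Suc n)" unfolding ex_def[of n] by (rule Least_le) (use exS sub in blast)
    have left: "(\<exists>j\<le>i. Y j \<omega> \<notin> Bl (\<rho> n)) \<longleftrightarrow> ex n \<le> i" for i
      using exn inn by (meson leD le_less_linear le_trans)
    have "\<tau> n < (\<Sum>i<ex (Suc n). if \<exists>j\<le>i. Y j \<omega> \<notin> Bl (\<rho> n) then holding i \<omega> else 0)"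
      using slow[OF step.hyps(1), of "ex (Suc n)"] exS inS unfolding exits_fast_def by auto
    also have "\<dots> = (\<Sum>i\<in>{ex n..<ex (Suc n)}. holding i \<omega>)"
      unfolding left by (intro sum.mono_neutral_cong_right) auto
    finally have \<tau>: "\<tau> n < (\<Sum>i\<in>{ex n..<ex (Suc n)}. holding i \<omega>)" .
    have "(\<Sum>i<ex (Suc n). holding i \<omega>) = (\<Sum>i<ex n. holding i \<omega>) + (\<Sum>i\<in>{ex n..<ex (Suc n)}. holding i \<omega>)"
      using le by (subst sum.union_disjoint[symmetric]) (auto intro!: sum.cong)
    then show ?case using step.IH[OF exn] step.hyps(1) \<tau> by (simp add: jump_time_eq)
  qed
  from this[OF out] have "(\<Sum>j\<in>{N..<n}. \<tau> j) \<le> jump_time w \<mu> Y E (ex n) \<omega>" .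
  also have "\<dots> \<le> jump_time w \<mu> Y E k \<omega>"
    using pos out by (intro jump_time_mono) (auto simp: ex_def intro: Least_le)
  finally show ?thesis .
qed

text \<open>Either the path stays in one of the finite balls, where the jump rates are bounded and
  the sum of the exponential variables diverges, or it leaves every ball and its exit times dominate
  the divergent sums of \<tau>.\<close>

lemma lifetime_infinite:
  fixes \<rho> \<tau> :: "nat \<Rightarrow> real"
  assumes pos: "\<And>n. 0 < E n \<omega>" and unb: "\<And>C. \<exists>n. C < (\<Sum>i<n. E i \<omega>)" and \<rho>: "incseq \<rho>"
    and slow: "\<And>j k. N \<le> j \<Longrightarrow> \<not> exits_fast (\<rho> j) (\<rho> (Suc j)) (\<tau> j) k \<omega>"
    and div: "\<And>C. \<exists>n\<ge>N. C < (\<Sum>j\<in>{N..<n}. \<tau> j)"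
  shows "lifetime w \<mu> Y E \<omega> = \<infinity>"
proof -
  have "\<exists>k. C < jump_time w \<mu> Y E k \<omega>" for C
  proof (cases "\<exists>m. \<forall>k. Y k \<omega> \<in> Bl (\<rho> m)")
    case True
    then obtain m where m: "\<And>k. Y k \<omega> \<in> Bl (\<rho> m)" by blast
    define q where "q = Max (jump_rate w \<mu> ` Bl (\<rho> m))"
    have q: "jump_rate w \<mu> (Y k \<omega>) \<le> q" for k
      unfolding q_def using finite_Bl m by (intro Max_ge) auto
    then have q0: "0 < q" using jump_rate_pos less_le_trans by blast
    obtain n where n: "\<bar>C\<bar> * q < (\<Sum>i<n. E i \<omega>)" using unb by blast
    have "C \<le> \<bar>C\<bar>" by simp
    also have "\<bar>C\<bar> < (\<Sum>i<n. E i \<omega>) / q" using n q0 by (simp add: pos_less_divide_eq)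
    also have "\<dots> \<le> jump_time w \<mu> Y E n \<omega>"
      unfolding jump_time_eq sum_divide_distrib holding_def
      using q jump_rate_pos pos by (intro sum_mono divide_left_mono) (auto intro: less_imp_le mult_pos_pos q0)
    finally show ?thesis by blast
  next
    case False
    obtain n where n: "N \<le> n" "C < (\<Sum>j\<in>{N..<n}. \<tau> j)" using div by blast
    obtain k where "Y k \<omega> \<notin> Bl (\<rho> n)" using False by blast
    then have "(\<Sum>j\<in>{N..<n}. \<tau> j) \<le> jump_time w \<mu> Y E k \<omega>"
      using jump_time_exit_ge[OF pos \<rho> n(1)] slow by blast
    then show ?thesis using n(2) less_le_trans by blast
  qed
  then have "\<exists>k. ereal C < ereal (jump_time w \<mu> Y E k \<omega>)" for C by simp
  then show ?thesis unfolding lifetime_def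
    by (intro SUP_PInfty) (metis less_imp_le UNIV_I)
qed

end

section \<open>Divergence and the rate function\<close>

locale diverging_graph = adapted_graph +
  assumes diverge: "(\<integral>\<^sup>+ r. ennreal (r * (1 / ln (vol r))) * indicator {a..} r \<partial>lborel) = \<infinity>"
begin

text \<open>From radius \<open>4 ^ n0\<close> on, \<open>C0 * r\<close> is at least
  \<open>4 * sqrt r\<close>, and all volume and logarithm bounds hold at once. The same radius
  serves as \<open>Rhat\<close>.\<close>

definition n0 :: nat where "n0 = (SOME n. 1 \<le> n \<and> 4 \<le> C0 * 2 ^ n)"

lemma n0: "1 \<le> n0" "4 \<le> C0 * 2 ^ n0"
proof -
  obtain n :: nat where n: "4 / C0 < 2 ^ n" using real_arch_pow[of 2 "4 / C0"] by auto
  have "(2::real) ^ n \<le> 2 ^ Suc n" by simp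
  then have "1 \<le> Suc n \<and> 4 \<le> C0 * 2 ^ Suc n" using n C0(1) by (simp add: field_simps)
  from someI[of "\<lambda>n. 1 \<le> n \<and> 4 \<le> C0 * 2 ^ n", OF this] show "1 \<le> n0" "4 \<le> C0 * 2 ^ n0"
    by (auto simp: n0_def)
qed

lemma vol_large:
  assumes "(4 :: real) ^ n0 \<le> r"
  shows "4 \<le> r" "4 * sqrt r \<le> vol r" "2 \<le> vol r" "16 / C0 \<le> vol r" "1 < ln r" "ln r \<le> vol r"
proof -
  have "(4::real) ^ 1 \<le> 4 ^ n0" using n0(1) by (intro power_increasing) auto
  then show r4: "4 \<le> r" using assms by simp
  have sr: "2 ^ n0 \<le> sqrt r"
  proof -
    have "(2 ^ n0)\<^sup>2 \<le> r" using assms by (simp add: power_mult[symmetric] mult.commute[of n0])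
       (simp add: power_mult)
    then show ?thesis by (rule real_le_rsqrt)
  qed
  have C: "4 \<le> C0 * sqrt r"
    using n0(2) mult_left_mono[OF sr, of C0] C0(1) by linarith
  have "4 * sqrt r \<le> C0 * sqrt r * sqrt r" using C r4 by (intro mult_right_mono) auto
  also have "\<dots> = C0 * r" using r4 by simp
  also have "\<dots> \<le> vol r" using r4 by (intro vol_ge) simp
  finally show v: "4 * sqrt r \<le> vol r" .
  have "2 \<le> sqrt r" using r4 real_le_rsqrt[of 2 r] by simp
  then show "2 \<le> vol r" using v by linarith
  have "4 * sqrt r \<ge> 16 / C0" using C C0(1) by (simp add: field_simps)
  then show "16 / C0 \<le> vol r" using v by linarith
  have "exp 1 < (4::real)" using exp_le by linarith
  then have "exp 1 < r" using r4 by linarith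
  then have "ln (exp 1) < ln r" using r4 by (subst ln_less_cancel_iff) auto
  then show "1 < ln r" by simp
  have "ln (sqrt r) \<le> sqrt r - 1" using r4 by (intro ln_le_minus_one) simp
  then have "ln r \<le> 2 * sqrt r" using r4 by (simp add: ln_sqrt)
  then show "ln r \<le> vol r" using v r4 by (smt (verit) real_sqrt_ge_zero)
qed

lemma four_power_ge: "n0 \<le> n \<Longrightarrow> (4::real) ^ n0 \<le> 4 ^ n"
  by (intro power_increasing) auto

definition lv :: "real \<Rightarrow> real" where "lv r = ln (vol r)"

lemma lv_mono: "4 ^ n0 \<le> r \<Longrightarrow> r \<le> r' \<Longrightarrow> lv r \<le> lv r'"
  using vol_large(3)[of r] vol_mono[of r r'] by (simp add: lv_def)

lemma lv_pos: "4 ^ n0 \<le> r \<Longrightarrow> 0 < lv r"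
  using vol_large(3)[of r] by (simp add: lv_def)

text \<open>With \<open>R = 4 ^ Suc n\<close>, \<open>L = lv R\<close> and
  \<open>s = 16 * L / R\<close> this gives \<open>s\<^sup>2 * tau n = L / 8\<close>, so the cost
  \<open>4 * \<theta> * s\<^sup>2 * tau n\<close> is half of the gain \<open>\<theta> * L\<close>.
  The index is that of the inner radius.\<close>

definition tau :: "nat \<Rightarrow> real" where "tau n = (4 ^ Suc n)\<^sup>2 / (2048 * lv (4 ^ Suc n))"

lemma tau_pos: "n0 \<le> Suc n \<Longrightarrow> 0 < tau n"
  using lv_pos[OF four_power_ge, of "Suc n"] by (simp add: tau_def)

lemma tau_eq: "n0 \<le> Suc n \<Longrightarrow> (4 ^ Suc (Suc n))\<^sup>2 / lv (4 ^ Suc n) = 32768 * tau n"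
  by (simp add: tau_def power2_eq_square)

text \<open>On the shell from \<open>4 ^ m\<close> to \<open>4 ^ Suc m\<close> the integral is at
  most \<open>(4 ^ Suc m)\<^sup>2 / lv (4 ^ m)\<close>, which by \<open>tau_eq\<close> is a multiple
  of \<open>tau (m - 1)\<close>. Since the shells start at \<open>m = n0\<close>, the series starts
  at \<open>n0 - 1\<close>.\<close>

lemma tau_not_summable: "\<not> summable (\<lambda>k. tau (n0 - 1 + k))"
proof
  assume sm: "summable (\<lambda>k. tau (n0 - 1 + k))"
  have Suc0: "Suc (n0 - 1 + k) = n0 + k" for k using n0(1) by simp
  define I where "I k = {4 ^ (n0 + k) ..< (4::real) ^ Suc (n0 + k)}" for k
  define B where "B k = 4 ^ Suc (n0 + k) / lv (4 ^ (n0 + k))" for k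
  have lvp: "0 < lv (4 ^ (n0 + k))" for k by (intro lv_pos four_power_ge) simp
  have B: "0 \<le> B k" for k using lvp[of k] by (simp add: B_def)
  have le: "ennreal (r * (1 / ln (vol r))) * indicator {4 ^ n0..} r \<le> (\<Sum>k. ennreal (B k) * indicator (I k) r)" for r
  proof (cases "4 ^ n0 \<le> r")
    case True
    define m where "m = (LEAST m. r < 4 ^ m)"
    obtain m' :: nat where "r < 4 ^ m'" using real_arch_pow[of 4 r] by auto
    then have m: "r < 4 ^ m" unfolding m_def by (rule LeastI)
    have "n0 < m" using True m by (meson le_less_trans power_less_imp_less_exp one_less_numeral_iff semiring_norm(76))
    then obtain k where k: "m = Suc (n0 + k)" using less_imp_Suc_add by blast
    have "\<not> r < 4 ^ (n0 + k)" using not_less_Least[of "n0 + k" "\<lambda>m. r < 4 ^ m"] k by (simp add: m_def)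
    then have rk: "4 ^ (n0 + k) \<le> r" "r \<in> I k" using m k by (auto simp: I_def)
    have "r * (1 / ln (vol r)) \<le> B k"
      unfolding B_def lv_def[symmetric] using lv_mono[OF four_power_ge rk(1)] lvp[of k] m k True
      by (simp add: divide_simps del: power_Suc)
         (meson less_imp_le lv_pos mult_mono order_trans zero_le_numeral zero_le_power)
    then have "ennreal (r * (1 / ln (vol r))) * indicator {4 ^ n0..} r \<le> ennreal (B k) * indicator (I k) r"
      using True rk(2) by (simp add: ennreal_leI)
    also have "\<dots> \<le> (\<Sum>k. ennreal (B k) * indicator (I k) r)"
    proof -
      define f where "f i = ennreal (B i) * indicator (I i) r" for i
      have "f k \<le> (\<Sum>i. f i)" using sum_le_suminf[of f "{k}"] by simp
      then show ?thesis by (simp add: f_def)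
    qed
    finally show ?thesis .
  qed simp
  have "(\<integral>\<^sup>+ r. ennreal (r * (1 / ln (vol r))) * indicator {4 ^ n0..} r \<partial>lborel)
      \<le> (\<integral>\<^sup>+ r. (\<Sum>k. ennreal (B k) * indicator (I k) r) \<partial>lborel)"
    by (intro nn_integral_mono le)
  also have "\<dots> = (\<Sum>k. \<integral>\<^sup>+ r. ennreal (B k) * indicator (I k) r \<partial>lborel)"
    by (rule nn_integral_suminf) (simp add: I_def)
  also have "\<dots> \<le> (\<Sum>k. ennreal (32768 * tau (n0 - 1 + k)))"
  proof (rule suminf_le)
    fix k
    have "(\<integral>\<^sup>+ r. ennreal (B k) * indicator (I k) r \<partial>lborel) = ennreal (B k) * emeasure lborel (I k)"
      by (rule nn_integral_cmult_indicator) (simp add: I_def)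
    also have "emeasure lborel (I k) = ennreal (4 ^ Suc (n0 + k) - 4 ^ (n0 + k))" by (simp add: I_def)
    also have "\<dots> \<le> ennreal (4 ^ Suc (n0 + k))" by (intro ennreal_leI) simp
    also have "ennreal (B k) * ennreal (4 ^ Suc (n0 + k)) = ennreal (B k * 4 ^ Suc (n0 + k))"
      using B by (intro ennreal_mult[symmetric]) auto
    also have "B k * 4 ^ Suc (n0 + k) = 32768 * tau (n0 - 1 + k)"
      using tau_eq[of "n0 - 1 + k"] n0(1) by (simp add: B_def Suc0 power2_eq_square)
    finally show "(\<integral>\<^sup>+ r. ennreal (B k) * indicator (I k) r \<partial>lborel) \<le> ennreal (32768 * tau (n0 - 1 + k))"
      by (simp add: mult_left_mono)
  qed auto
  also have "\<dots> = ennreal (\<Sum>k. 32768 * tau (n0 - 1 + k))"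
    using sm tau_pos n0(1) by (intro suminf_ennreal2) (auto intro!: less_imp_le summable_mult)
  finally show False unfolding diverge by (simp add: top_unique)
qed

lemma sum_tau_unbounded: "n0 - 1 \<le> N \<Longrightarrow> \<exists>n\<ge>N. C < (\<Sum>j\<in>{N..<n}. tau j)"
proof (rule ccontr)
  assume N: "n0 - 1 \<le> N" and "\<not> (\<exists>n\<ge>N. C < (\<Sum>j\<in>{N..<n}. tau j))"
  then have bd: "(\<Sum>j\<in>{N..<n}. tau j) \<le> C" if "N \<le> n" for n using that not_less by blast
  have "summable (\<lambda>k. tau (N + k))"
  proof (rule summableI_nonneg_bounded)
    show "0 \<le> tau (N + k)" for k
    proof -
      have "n0 \<le> Suc (N + k)" using N by linarith
      then show ?thesis using tau_pos[of "N + k"] by simp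
    qed
    show "(\<Sum>k<n. tau (N + k)) \<le> C" for n
      using bd[of "N + n"] sum.shift_bounds_nat_ivl[of tau 0 N n] by (simp add: atLeast0LessThan add.commute)
  qed
  then have "summable (\<lambda>k. tau (k + (N - (n0 - 1)) + (n0 - 1)))" using N by (simp add: add.commute)
  then have "summable (\<lambda>k. tau (k + (n0 - 1)))"
    using summable_iff_shift[of "\<lambda>k. tau (k + (n0 - 1))" "N - (n0 - 1)"] by simp
  then show False using tau_not_summable by (simp add: add.commute)
qed

definition rate_integrand :: "real \<Rightarrow> real" where
  "rate_integrand r = r * (1 / (lv r + ln (ln r)))"

text \<open>Since \<open>ln r \<le> vol r\<close>, the term \<open>ln (ln r)\<close> lies between 0
  and \<open>lv r\<close> and at most doubles the denominator.\<close>

lemma rate_integrand_bounds: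
  assumes "4 ^ n0 \<le> r"
  shows "r / (2 * lv r) \<le> rate_integrand r" "rate_integrand r \<le> r / lv r"
proof -
  note v = vol_large[OF assms]
  have l: "0 \<le> ln (ln r)" using v by simp
  have d: "0 < lv r + ln (ln r)" using l lv_pos[OF assms] by linarith
  have "ln (ln r) \<le> lv r" using v unfolding lv_def by simp
  then have "r / (2 * lv r) \<le> r / (lv r + ln (ln r))" "r / (lv r + ln (ln r)) \<le> r / lv r"
    using l d lv_pos[OF assms] v(1) by (auto intro!: divide_left_mono mult_pos_pos)
  then show "r / (2 * lv r) \<le> rate_integrand r" "rate_integrand r \<le> r / lv r"
    by (simp_all add: rate_integrand_def)
qed

lemma rate_integrand_le:
  assumes "4 ^ n0 \<le> a" "a \<le> r" "r \<le> b" shows "rate_integrand r \<le> b / lv a"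
proof -
  have "rate_integrand r \<le> r / lv r" using assms by (intro rate_integrand_bounds) simp
  also have "\<dots> \<le> b / lv a"
    using assms lv_mono[of a r] lv_pos[of a] vol_large(1)[of a] by (intro frac_le) auto
  finally show ?thesis .
qed

lemma rate_integrand_ge:
  assumes "4 ^ n0 \<le> a" "a \<le> r" "r \<le> b" shows "a / (2 * lv b) \<le> rate_integrand r"
proof -
  have "a / (2 * lv b) \<le> r / (2 * lv r)"
    using assms lv_mono[of r b] lv_pos[of r] vol_large(1)[of a] by (intro frac_le) auto
  also have "\<dots> \<le> rate_integrand r" using assms by (intro rate_integrand_bounds) simp
  finally show ?thesis .
qed

lemma rate_integrand_integrable:
  assumes "4 ^ n0 \<le> a" shows "rate_integrand integrable_on {a..b}"
proof -
  have "mono vol" by (intro monoI vol_mono)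
  then have [measurable]: "vol \<in> borel_measurable borel" by (rule borel_measurable_mono)
  have [measurable]: "rate_integrand \<in> borel_measurable borel"
    unfolding rate_integrand_def[abs_def] lv_def by measurable
  have "norm (rate_integrand r) \<le> b / lv a" if "r \<in> {a..b}" for r
  proof -
    have "0 \<le> a / (2 * lv b)" using that assms lv_pos[of b] vol_large(1)[of a] by simp
    then show ?thesis using rate_integrand_le[OF assms, of r b] rate_integrand_ge[OF assms, of r b] that by simp
  qed
  then have "set_integrable lborel {a..b} rate_integrand"
    unfolding set_integrable_def
    by (intro integrableI_bounded_set_indicator[where B = "b / lv a"]) (auto simp: emeasure_lborel_Icc_eq)
  then show ?thesis by (rule set_borel_integral_eq_integral(1))
qed

lemma integral_rate_integrand_bounds:
  assumes "4 ^ n0 \<le> a" "a \<le> b"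
  shows "(b - a) * (a / (2 * lv b)) \<le> integral {a..b} rate_integrand"
    "integral {a..b} rate_integrand \<le> (b - a) * (b / lv a)"
proof -
  have "integral {a..b} (\<lambda>_. a / (2 * lv b)) \<le> integral {a..b} rate_integrand"
    using assms by (intro integral_le rate_integrand_integrable rate_integrand_ge) auto
  then show "(b - a) * (a / (2 * lv b)) \<le> integral {a..b} rate_integrand" using assms by simp
  have "integral {a..b} rate_integrand \<le> integral {a..b} (\<lambda>_. b / lv a)"
    using assms by (intro integral_le rate_integrand_integrable rate_integrand_le) auto
  then show "integral {a..b} rate_integrand \<le> (b - a) * (b / lv a)" using assms by simp
qed

text \<open>The constant \<open>1 / 65536\<close> is half the inverse of the factor in \<open>tau_eq\<close>.\<close>

definition psi :: "real \<Rightarrow> real" where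
  "psi R = 1 / 65536 * integral {4 ^ n0..R} rate_integrand"

lemma psi_diff:
  assumes "4 ^ n0 \<le> a" "a \<le> b"
  shows "psi b = psi a + 1 / 65536 * integral {a..b} rate_integrand"
  using Henstock_Kurzweil_Integration.integral_combine[OF assms rate_integrand_integrable]
  by (simp add: psi_def algebra_simps)

lemma psi_0: "psi (4 ^ n0) = 0"
  by (simp add: psi_def)

lemma psi_less: "4 ^ n0 \<le> a \<Longrightarrow> a < b \<Longrightarrow> psi a < psi b"
proof -
  assume ab: "4 ^ n0 \<le> a" "a < b"
  have "0 < (b - a) * (a / (2 * lv b))"
    using ab lv_pos[of b] vol_large(1)[of a] by (intro mult_pos_pos divide_pos_pos) auto
  also have "\<dots> \<le> integral {a..b} rate_integrand" using ab by (intro integral_rate_integrand_bounds) auto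
  finally show ?thesis using psi_diff[of a b] ab by simp
qed

lemma psi_le_iff: "4 ^ n0 \<le> a \<Longrightarrow> 4 ^ n0 \<le> b \<Longrightarrow> psi a \<le> psi b \<longleftrightarrow> a \<le> b"
  using psi_less[of a b] psi_less[of b a] by (metis less_le_not_le linorder_linear order_less_le)

text \<open>The shell from \<open>4 ^ n\<close> to \<open>4 ^ Suc n\<close> contributes at most half
  of \<open>tau (n - 1)\<close> to \<open>psi\<close>. The spare factor 2 later makes up for the
  finitely many scales that are not slow.\<close>

lemma psi_four_power_le: "n0 \<le> n \<Longrightarrow> 2 * psi (4 ^ Suc n) \<le> (\<Sum>j\<in>{n0 - 1..<n}. tau j)"
proof -
  have psi_step: "2 * psi (4 ^ Suc n) \<le> 2 * psi (4 ^ n) + tau (n - 1)" if n: "n0 \<le> n" for n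
  proof -
    have n1: "Suc (n - 1) = n" using n n0(1) by simp
    have "integral {4 ^ n..4 ^ Suc n} rate_integrand \<le> (4 ^ Suc n - 4 ^ n) * (4 ^ Suc n / lv (4 ^ n))"
      using n by (intro integral_rate_integrand_bounds four_power_ge) auto
    also have "\<dots> \<le> 4 ^ Suc n * (4 ^ Suc n / lv (4 ^ n))"
      using lv_pos[OF four_power_ge[OF n]] by (intro mult_right_mono) auto
    also have "\<dots> = 32768 * tau (n - 1)"
      using tau_eq[of "n - 1"] n n1 by (simp add: power2_eq_square)
    finally show ?thesis using psi_diff[of "4 ^ n" "4 ^ Suc n"] four_power_ge[OF n] by simp
  qed
  show "n0 \<le> n \<Longrightarrow> ?thesis"
  proof (induction n rule: dec_induct)
    case base
    have "{n0 - 1..<n0} = {n0 - 1}" using n0(1) by auto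
    then show ?case using psi_step[of n0] by (simp add: psi_0)
  next
    case (step n)
    have "{n0 - 1..<Suc n} = insert n {n0 - 1..<n}" using step.hyps by auto
    then show ?case using step.IH psi_step[of "Suc n"] step.hyps by simp
  qed
qed

text \<open>Needed for unboundedness of \<open>psi\<close>, hence for an inverse on all of the
  half-line. The constant is 192 / 65536, the ratio of the shell's lower bound to
  \<open>tau n\<close> being 192.\<close>

lemma psi_four_power_ge: "n0 \<le> n \<Longrightarrow> 3 / 1024 * (\<Sum>j\<in>{n0..<n}. tau j) \<le> psi (4 ^ n)"
proof (induction n rule: dec_induct)
  case base
  then show ?case by (simp add: psi_0)
next
  case (step n)
  have "65536 * (3 / 1024 * tau n) = (4 ^ Suc n - 4 ^ n) * (4 ^ n / (2 * lv (4 ^ Suc n)))"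
    by (simp add: tau_def power2_eq_square)
  also have "\<dots> \<le> integral {4 ^ n..4 ^ Suc n} rate_integrand"
    using step.hyps by (intro integral_rate_integrand_bounds four_power_ge) auto
  finally show ?case
    using step psi_diff[of "4 ^ n" "4 ^ Suc n"] four_power_ge[OF step.hyps(1)]
    by (simp add: distrib_left)
qed

lemma psi_surj: "0 \<le> t \<Longrightarrow> \<exists>R\<ge>4 ^ n0. psi R = t"
proof -
  assume t: "0 \<le> t"
  obtain n where n: "n0 \<le> n" "1024 / 3 * t < (\<Sum>j\<in>{n0..<n}. tau j)"
    using sum_tau_unbounded[of n0 "1024 / 3 * t"] by auto
  have "t \<le> psi (4 ^ n)" using psi_four_power_ge[OF n(1)] n(2) by linarith
  moreover have "continuous_on {4 ^ n0..4 ^ n} psi"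
    unfolding psi_def[abs_def]
    by (intro continuous_intros indefinite_integral_continuous_1 rate_integrand_integrable) simp
  ultimately show ?thesis
    using IVT'[of psi "4 ^ n0" t "4 ^ n"] t four_power_ge[OF n(1)] by (auto simp: psi_0)
qed

text \<open>An integral over an empty interval is 0, so \<open>psi\<close> vanishes also below
  \<open>4 ^ n0\<close>; the lower bound on \<open>R\<close> singles out one preimage of 0.\<close>

definition psi_inv :: "real \<Rightarrow> real" where
  "psi_inv t = (THE R. 4 ^ n0 \<le> R \<and> psi R = t)"

lemma psi_inv_psi: "4 ^ n0 \<le> R \<Longrightarrow> psi_inv (psi R) = R"
  unfolding psi_inv_def by (rule the_equality) (auto intro: antisym simp: psi_le_iff[symmetric])

lemma psi_psi_inv: "0 \<le> t \<Longrightarrow> 4 ^ n0 \<le> psi_inv t \<and> psi (psi_inv t) = t"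
  using psi_surj[of t] psi_inv_psi by auto

lemma psi_nonneg: "4 ^ n0 \<le> R \<Longrightarrow> 0 \<le> psi R"
  using psi_le_iff[of "4 ^ n0" R] by (simp add: psi_0)

lemma le_psi_inv_iff: "4 ^ n0 \<le> R \<Longrightarrow> 0 \<le> t \<Longrightarrow> R \<le> psi_inv t \<longleftrightarrow> psi R \<le> t"
  using psi_psi_inv[of t] psi_le_iff[of R "psi_inv t"] by auto

lemma psi_inv_mono: "0 \<le> t \<Longrightarrow> t \<le> t' \<Longrightarrow> psi_inv t \<le> psi_inv t'"
  using le_psi_inv_iff[of "psi_inv t" t'] psi_psi_inv[of t] by auto

text \<open>Once the sum from \<open>N\<close> on exceeds the initial part before \<open>N\<close>,
  twice this sum dominates the full sum and hence \<open>2 * psi (4 ^ Suc n)\<close>.\<close>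

lemma psi_eventually_le_sum_tau:
  assumes N: "n0 \<le> N"
  shows "\<exists>m\<ge>N. \<forall>n\<ge>m. psi (4 ^ Suc n) \<le> (\<Sum>j\<in>{N..<n}. tau j)"
proof -
  obtain m where m: "N \<le> m" "(\<Sum>j\<in>{n0 - 1..<N}. tau j) < (\<Sum>j\<in>{N..<m}. tau j)"
    using sum_tau_unbounded[OF le_trans[OF diff_le_self N]] by blast
  have "psi (4 ^ Suc n) \<le> (\<Sum>j\<in>{N..<n}. tau j)" if n: "m \<le> n" for n
  proof -
    have "(\<Sum>j\<in>{N..<m}. tau j) \<le> (\<Sum>j\<in>{N..<n}. tau j)"
      using n N tau_pos by (intro sum_mono2) (auto intro: less_imp_le)
    moreover have "(\<Sum>j\<in>{n0 - 1..<n}. tau j) = (\<Sum>j\<in>{n0 - 1..<N}. tau j) + (\<Sum>j\<in>{N..<n}. tau j)"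
      using n m N by (intro sum.atLeastLessThan_concat[symmetric]) auto
    ultimately show ?thesis using psi_four_power_le[of n] n m N by linarith
  qed
  then show ?thesis using m(1) by blast
qed

end

section \<open>Passage times\<close>

locale diverging_chain = diverging_graph + adapted_chain
begin

definition slow_from :: "nat \<Rightarrow> 'b \<Rightarrow> bool" where
  "slow_from N \<omega> \<longleftrightarrow> n0 \<le> N \<and> (\<forall>j\<ge>N. \<forall>k. \<not> exits_fast (4 ^ j) (4 ^ Suc j) (tau j) k \<omega>)"

lemma slow_from_measurable [measurable]: "Measurable.pred M (slow_from N)"
  unfolding slow_from_def[abs_def] by measurable

text \<open>By the choice of \<open>tau\<close> the exponent is \<open>- \<theta> * L / 2\<close>,
  with \<open>\<theta> * L\<close> the minimum of \<open>L / 4\<close> and \<open>R / 32\<close>.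
  Both are at least \<open>Suc n / 32\<close>: the first since
  \<open>vol R \<ge> sqrt R = 2 ^ Suc n\<close>, the second since
  \<open>R \<ge> Suc n\<close>.\<close>

lemma prob_fast_le:
  assumes n: "n0 \<le> n" and x0: "x0 \<in> Bl (4 ^ n)"
  shows "prob {\<omega> \<in> space M. \<exists>k. exits_fast (4 ^ n) (4 ^ Suc n) (tau n) k \<omega>} \<le> exp (- 1 / 64) ^ Suc n"
proof -
  define R where "R = (4::real) ^ Suc n"
  define L where "L = ln (vol R)"
  define s where "s = 16 * L / R"
  define \<theta> where "\<theta> = min (1 / 4) (1 / (2 * s))"
  have R0: "4 ^ n0 \<le> R" unfolding R_def using n by (intro four_power_ge) simp
  note v = vol_large[OF R0]
  have R: "0 < R" using v(1) by simp
  have L: "0 < L" using v(3) by (simp add: L_def)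
  have s: "0 < s" using L R by (simp add: s_def)
  have "(4::real) ^ 1 \<le> 4 ^ n" using n n0(1) by (intro power_increasing) auto
  then have "4 ^ n + 1 \<le> R / 2" by (simp add: R_def)
  then have "prob {\<omega> \<in> space M. \<exists>k. exits_fast (4 ^ n) R (tau n) k \<omega>} \<le> exp (4 * \<theta> * s\<^sup>2 * tau n - \<theta> * L)"
    using prob_exits_fast[OF R _ v(3,4) x0, of "tau n"] by (simp add: L_def s_def \<theta>_def)
  also have "4 * \<theta> * s\<^sup>2 * tau n - \<theta> * L = - (\<theta> * L) / 2"
  proof -
    have "tau n = R\<^sup>2 / (2048 * L)" by (simp only: tau_def lv_def R_def L_def)
    then have "s\<^sup>2 * tau n = L / 8" using L R by (simp add: s_def power2_eq_square)
    then have "4 * \<theta> * (s\<^sup>2 * tau n) = \<theta> * L / 2" by simp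
    moreover have "4 * \<theta> * (s\<^sup>2 * tau n) = 4 * \<theta> * s\<^sup>2 * tau n" by (simp only: mult.assoc)
    ultimately show ?thesis by linarith
  qed
  also have "exp (- (\<theta> * L) / 2) \<le> exp (- real (Suc n) / 64)"
  proof -
    have "real (Suc n) / 32 \<le> L / 4"
    proof -
      have "(2 ^ Suc n)\<^sup>2 = R"
        unfolding R_def by (simp only: power2_eq_square power_mult_distrib[symmetric]) simp
      then have "sqrt R = 2 ^ Suc n" by (intro real_sqrt_unique) auto
      then have "2 ^ Suc n \<le> vol R" using v(2) R by (smt (verit) real_sqrt_ge_zero)
      then have "ln (2 ^ Suc n) \<le> L" unfolding L_def using v(3) by (subst ln_le_cancel_iff) auto
      then have "real (Suc n) * ln 2 \<le> L" by (simp only: ln_realpow)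
      moreover have "real (Suc n) * (1 / 8) \<le> real (Suc n) * ln 2"
        using ln2_ge_two_thirds by (intro mult_left_mono) auto
      ultimately show ?thesis by linarith
    qed
    moreover have "real (Suc n) / 32 \<le> L / (2 * s)"
    proof -
      have "real (Suc n) < 2 ^ Suc n" by (rule of_nat_less_two_power)
      also have "(2::real) ^ Suc n \<le> R" unfolding R_def by (rule power_mono) auto
      finally have "real (Suc n) \<le> R" by simp
      moreover have "L / (2 * s) = R / 32" using L R by (simp add: s_def)
      ultimately show ?thesis by simp
    qed
    moreover have "\<theta> * L = min (L / 4) (L / (2 * s))" using L by (simp add: \<theta>_def min_mult_distrib_right)
    ultimately have "real (Suc n) / 32 \<le> \<theta> * L" by simp
    then have "- (\<theta> * L) / 2 \<le> - real (Suc n) / 64" by linarith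
    then show ?thesis by (simp only: exp_le_cancel_iff)
  qed
  also have "\<dots> = exp (- 1 / 64) ^ Suc n" by (simp add: exp_of_nat_mult[symmetric] del: of_nat_Suc power_Suc)
  finally show ?thesis by (simp add: R_def)
qed

lemma AE_slow: "AE \<omega> in M. \<exists>N. slow_from N \<omega>"
proof -
  define A where "A n = {\<omega> \<in> space M. \<exists>k. exits_fast (4 ^ n) (4 ^ Suc n) (tau n) k \<omega>}" for n
  obtain m :: nat where m: "dist0 x0 < 4 ^ m" using real_arch_pow[of 4 "dist0 x0"] by auto
  have le: "prob (A n) \<le> exp (- 1 / 64) ^ Suc n" if "max n0 m \<le> n" for n
  proof -
    have "(4::real) ^ m \<le> 4 ^ n" using that by (intro power_increasing) auto
    then have "dist0 x0 \<le> 4 ^ n" using m by linarith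
    then have "x0 \<in> Bl (4 ^ n)" by (simp add: Bl_def)
    then show ?thesis unfolding A_def using that by (intro prob_fast_le) auto
  qed
  have "summable (\<lambda>n. exp (- 1 / 64 :: real) ^ n)" by (rule summable_geometric) simp
  then have geo: "summable (\<lambda>n. exp (- 1 / 64 :: real) ^ Suc n)" by (subst summable_Suc_iff)
  have "summable (\<lambda>n. prob (A n))"
  proof (rule summable_comparison_test'[OF geo])
    show "norm (prob (A n)) \<le> exp (- 1 / 64) ^ Suc n" if "max n0 m \<le> n" for n
      using le[OF that] by (simp only: real_norm_def abs_of_nonneg[OF measure_nonneg])
  qed
  then have "AE \<omega> in M. eventually (\<lambda>n. \<omega> \<in> space M - A n) sequentially"
    by (intro borel_cantelli_AE1) (auto simp: A_def emeasure_eq_measure)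
  then show ?thesis
  proof eventually_elim
    case (elim \<omega>)
    then obtain N where "\<And>n. N \<le> n \<Longrightarrow> \<omega> \<in> space M - A n" by (auto simp: eventually_sequentially)
    then have "slow_from (max n0 N) \<omega>" by (auto simp: slow_from_def A_def)
    then show ?case by blast
  qed
qed

lemma four_power_incseq: "incseq (\<lambda>j. (4::real) ^ j)"
  by (intro monoI power_increasing) auto

lemma AE_lifetime_infinite: "AE \<omega> in M. lifetime w \<mu> Y E \<omega> = \<infinity>"
  using AE_slow AE_E_pos AE_sum_E_unbounded
proof eventually_elim
  case (elim \<omega>)
  then obtain N where N: "slow_from N \<omega>" by blast
  show ?case
  proof (rule lifetime_infinite)
    show "0 < E n \<omega>" for n using elim by blast
    show "\<exists>n. C < (\<Sum>i<n. E i \<omega>)" for C using elim by blast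
    show "incseq (\<lambda>j. (4::real) ^ j)" by (rule four_power_incseq)
    show "\<not> exits_fast (4 ^ j) (4 ^ Suc j) (tau j) k \<omega>" if "N \<le> j" for j k
      using N that by (simp add: slow_from_def)
    show "\<exists>n\<ge>N. C < (\<Sum>j\<in>{N..<n}. tau j)" for C
      using N by (intro sum_tau_unbounded) (auto simp: slow_from_def)
  qed
qed

text \<open>A deterministic function of \<open>N\<close>: the random time of the rate function then
  depends on the path only through the least slow \<open>N\<close>, which makes it
  measurable.\<close>

definition settle_index :: "nat \<Rightarrow> nat" where
  "settle_index N = (SOME m. N \<le> m \<and> (\<forall>n\<ge>m. psi (4 ^ Suc n) \<le> (\<Sum>j\<in>{N..<n}. tau j)))"

lemma settle_index:
  assumes "n0 \<le> N"
  shows "N \<le> settle_index N" "settle_index N \<le> n \<Longrightarrow> psi (4 ^ Suc n) \<le> (\<Sum>j\<in>{N..<n}. tau j)"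
proof -
  from psi_eventually_le_sum_tau[OF assms] have "\<exists>m. N \<le> m \<and> (\<forall>n\<ge>m. psi (4 ^ Suc n) \<le> (\<Sum>j\<in>{N..<n}. tau j))"
    by blast
  from someI_ex[OF this] show "N \<le> settle_index N"
    "settle_index N \<le> n \<Longrightarrow> psi (4 ^ Suc n) \<le> (\<Sum>j\<in>{N..<n}. tau j)"
    unfolding settle_index_def by blast+
qed

lemma chain_state_index:
  assumes "0 \<le> t" "ereal t < lifetime w \<mu> Y E \<omega>"
  obtains k where "chain_state w \<mu> Y E t \<omega> = Y k \<omega>" "jump_time w \<mu> Y E k \<omega> \<le> t"
proof -
  let ?J = "\<lambda>n. jump_time w \<mu> Y E n \<omega>"
  define k where "k = (LEAST n. t < ?J (Suc n))"
  have "?J k \<le> t"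
  proof (cases k)
    case 0
    then show ?thesis using assms(1) by (simp add: jump_time_def)
  next
    case (Suc i)
    then have "\<not> t < ?J (Suc i)" using not_less_Least[of i "\<lambda>n. t < ?J (Suc n)"] by (simp add: k_def)
    then show ?thesis using Suc by simp
  qed
  then show ?thesis using that[of k] by (simp add: chain_state_def k_def)
qed

text \<open>A state beyond \<open>psi_inv t\<close> lies outside \<open>Bl (4 ^ n)\<close> but
  inside \<open>Bl (4 ^ Suc n)\<close> for some \<open>n\<close> past the settling index. Its jump
  time is at least the sum of \<open>tau\<close> below \<open>n\<close>, hence at least
  \<open>psi (4 ^ Suc n)\<close>, so \<open>psi_inv t\<close> already reaches
  \<open>4 ^ Suc n\<close>, a contradiction.\<close>

lemma dist0_chain_state_le:
  assumes pos: "\<And>n. 0 < E n \<omega>" and N: "slow_from N \<omega>"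
    and t: "psi (4 ^ settle_index N) \<le> t" "ereal t < lifetime w \<mu> Y E \<omega>"
  shows "dist0 (chain_state w \<mu> Y E t \<omega>) \<le> psi_inv t"
proof (rule ccontr)
  let ?m = "settle_index N"
  have nN: "n0 \<le> N" using N by (simp add: slow_from_def)
  note st = settle_index[OF nN]
  have m0: "(4::real) ^ n0 \<le> 4 ^ ?m" using nN st(1) by (intro four_power_ge) simp
  have t0: "0 \<le> t" using psi_nonneg[OF m0] t(1) by linarith
  obtain k where k: "chain_state w \<mu> Y E t \<omega> = Y k \<omega>" "jump_time w \<mu> Y E k \<omega> \<le> t"
    using chain_state_index[OF t0 t(2)] by blast
  assume "\<not> dist0 (chain_state w \<mu> Y E t \<omega>) \<le> psi_inv t"
  then have far: "psi_inv t < dist0 (Y k \<omega>)" using k(1) by simp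
  have "4 ^ ?m \<le> psi_inv t" using le_psi_inv_iff[OF m0 t0] t(1) by simp
  then have m: "4 ^ ?m < dist0 (Y k \<omega>)" using far by linarith
  \<comment> \<open>Rounding the distance up to a power of 4 costs one scale, which is why
    \<open>settle_index\<close> compares \<open>psi (4 ^ Suc n)\<close> with a sum that stops before
    \<open>n\<close>.\<close>
  define l where "l = (LEAST l. dist0 (Y k \<omega>) \<le> 4 ^ l)"
  obtain l' :: nat where "dist0 (Y k \<omega>) < 4 ^ l'" using real_arch_pow[of 4 "dist0 (Y k \<omega>)"] by auto
  then have "dist0 (Y k \<omega>) \<le> 4 ^ l'" by simp
  then have l: "dist0 (Y k \<omega>) \<le> 4 ^ l" unfolding l_def by (rule LeastI)
  have "(4::real) ^ ?m < 4 ^ l" using m l by linarith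
  then have "?m < l" by (rule power_less_imp_less_exp[rotated]) simp
  then obtain n where n: "l = Suc n" "?m \<le> n" by (cases l) auto
  have "Y k \<omega> \<notin> Bl (4 ^ n)"
    using not_less_Least[of n "\<lambda>l. dist0 (Y k \<omega>) \<le> 4 ^ l"] n(1) by (simp add: l_def Bl_def)
  moreover have "N \<le> n" using st(1) n(2) by simp
  moreover have "\<not> exits_fast (4 ^ j) (4 ^ Suc j) (tau j) i \<omega>" if "N \<le> j" for i j
    using N that by (simp add: slow_from_def)
  ultimately have "(\<Sum>j\<in>{N..<n}. tau j) \<le> jump_time w \<mu> Y E k \<omega>"
    by (rule jump_time_exit_ge[where \<rho> = "\<lambda>j. 4 ^ j", OF pos four_power_incseq, rotated 2])
  then have "psi (4 ^ Suc n) \<le> t" using st(2)[OF n(2)] k(2) by linarith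
  then have "4 ^ Suc n \<le> psi_inv t"
    using le_psi_inv_iff[OF _ t0, of "4 ^ Suc n"] four_power_ge[of "Suc n"] nN st(1) n(2) by simp
  then show False using far l n(1) by simp
qed

lemma exists_settling_time:
  "\<exists>T. T \<in> borel_measurable M \<and> (AE \<omega> in M. 0 \<le> T \<omega> \<and> ereal (T \<omega>) < lifetime w \<mu> Y E \<omega> \<and>
     (\<forall>t. T \<omega> \<le> t \<and> ereal t < lifetime w \<mu> Y E \<omega> \<longrightarrow> dist0 (chain_state w \<mu> Y E t \<omega>) \<le> psi_inv t))"
proof (intro exI conjI)
  define T where "T \<omega> = psi (4 ^ settle_index (LEAST N. slow_from N \<omega>))" for \<omega>
  have [measurable]: "(\<lambda>N. psi (4 ^ settle_index N)) \<in> borel_measurable (count_space UNIV)" by simp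
  show "T \<in> borel_measurable M"
    unfolding T_def[abs_def]
    by (rule measurable_compose[where g = "\<lambda>N. psi (4 ^ settle_index N)" and N = "count_space UNIV"]) measurable
  show "AE \<omega> in M. 0 \<le> T \<omega> \<and> ereal (T \<omega>) < lifetime w \<mu> Y E \<omega> \<and>
     (\<forall>t. T \<omega> \<le> t \<and> ereal t < lifetime w \<mu> Y E \<omega> \<longrightarrow> dist0 (chain_state w \<mu> Y E t \<omega>) \<le> psi_inv t)"
    using AE_slow AE_E_pos AE_lifetime_infinite
  proof eventually_elim
    case (elim \<omega>)
    define N where "N = (LEAST N. slow_from N \<omega>)"
    have N: "slow_from N \<omega>" unfolding N_def using elim(1) by (auto intro: LeastI_ex)
    then have "n0 \<le> settle_index N" using settle_index(1)[of N] by (simp add: slow_from_def)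
    then have "0 \<le> T \<omega>" unfolding T_def N_def[symmetric] by (intro psi_nonneg four_power_ge)
    moreover have "dist0 (chain_state w \<mu> Y E t \<omega>) \<le> psi_inv t"
      if "T \<omega> \<le> t" "ereal t < lifetime w \<mu> Y E \<omega>" for t
      using that elim(2) by (intro dist0_chain_state_le[OF _ N]) (auto simp: T_def N_def)
    ultimately show ?case using elim(3) by auto
  qed
qed

end

text \<open>An infinite ball has infinite measure because \<open>\<mu> \<ge> C0\<close>, and so have
  all larger ones. By the convention \<open>1 / log \<infinity> = 0\<close> the integrand then
  vanishes from that radius on.\<close>

lemma finite_balls_if_diverges:
  fixes \<mu> :: "'v::countable \<Rightarrow> real"
  assumes C0: "0 < C0" "\<And>x. C0 \<le> \<mu> x"
    and diverge: "\<And>a. (\<integral>\<^sup>+ r. ennreal (r * inv_log_plus (ball_measure \<mu> d x r) 0)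
                    * indicator {a..} r \<partial>lborel) = \<infinity>"
  shows "finite {y. d x y \<le> r}"
proof (rule ccontr)
  assume inf: "infinite {y. d x y \<le> r}"
  have "ball_measure \<mu> d x r' = \<infinity>" if "r \<le> r'" for r'
  proof -
    have "{y. d x y \<le> r} \<subseteq> {y. d x y \<le> r'}" using that by auto
    then have inf': "infinite {y. d x y \<le> r'}" using inf finite_subset by blast
    have "(\<integral>\<^sup>+ y. ennreal C0 \<partial>count_space {y. d x y \<le> r'}) \<le> ball_measure \<mu> d x r'"
      unfolding ball_measure_def using C0 by (intro nn_integral_mono ennreal_leI) auto
    moreover have "(\<integral>\<^sup>+ y. ennreal C0 \<partial>count_space {y. d x y \<le> r'}) = \<infinity>"
      using inf' C0(1) by (simp add: ennreal_mult_top)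
    ultimately show ?thesis by (simp add: top_unique)
  qed
  then have "ennreal (r' * inv_log_plus (ball_measure \<mu> d x r') 0) * indicator {r..} r' = 0" for r'
    by (cases "r \<le> r'") (auto simp: inv_log_plus_def)
  then have "(\<integral>\<^sup>+ r'. ennreal (r' * inv_log_plus (ball_measure \<mu> d x r') 0) * indicator {r..} r' \<partial>lborel)
      = (\<integral>\<^sup>+ r'. 0 \<partial>(lborel :: real measure))"
    by (intro nn_integral_cong)
  then show False using diverge[of r] by simp
qed

theorem theorem1p7:
  fixes w :: "'v::countable \<Rightarrow> 'v \<Rightarrow> real" and \<mu> :: "'v \<Rightarrow> real"
    and \<sigma> :: "'v \<Rightarrow> 'v \<Rightarrow> real" and xbar :: 'v
  assumes graph: "simple_weighted_graph w \<mu>"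
    and adapted: "adapted_weight w \<mu> \<sigma>"
    and Co: "(INF x. \<mu> x) > 0"
    and diverge: "\<forall>a::real. (\<integral>\<^sup>+ r. ennreal (r * inv_log_plus
                    (ball_measure \<mu> (adapted_path_metric w \<sigma>) xbar r) 0)
                    * indicator {a..} r \<partial>lborel) = \<infinity>"
  shows "conservative TYPE('w) w \<mu> \<and>
         (\<exists>c Rhat (\<psi>inv :: real \<Rightarrow> real).
           c > 0 \<and> Rhat \<ge> 1 \<and>
           (let \<psi> = (\<lambda>R. c * integral {Rhat..R} (\<lambda>r. r * inv_log_plus
                      (ball_measure \<mu> (adapted_path_metric w \<sigma>) xbar r) (ln (ln r))))
            in (\<forall>t\<ge>0. \<psi>inv t \<ge> Rhat \<and> \<psi> (\<psi>inv t) = t) \<and>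
               (\<forall>R\<ge>Rhat. \<psi> R \<ge> 0 \<and> \<psi>inv (\<psi> R) = R)) \<and>
           upper_rate_function TYPE('w) w \<mu> xbar (adapted_path_metric w \<sigma>) \<psi>inv)"
proof -
  define C0 where "C0 = (INF x. \<mu> x)"
  have C0: "0 < C0" using Co by (simp add: C0_def)
  have "bdd_below (range \<mu>)"
    using graph by (intro bdd_belowI[of _ 0]) (auto simp: simple_weighted_graph_def intro: less_imp_le)
  then have C0_le: "C0 \<le> \<mu> x" for x unfolding C0_def by (intro cINF_lower) auto
  interpret adapted_graph w \<mu> \<sigma> xbar C0
    using graph adapted C0 C0_le finite_balls_if_diverges[where \<mu> = \<mu>, OF C0 C0_le] diverge
    by unfold_locales blast+
  interpret diverging_graph w \<mu> \<sigma> xbar C0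
    using diverge by unfold_locales (simp add: inv_log_plus_vol)
  \<comment> \<open>The start \<open>x\<close> is arbitrary: conservativeness takes every
    \<open>x\<close>, the rate function takes \<open>x = xbar\<close>.\<close>
  have chain: "diverging_chain w \<mu> \<sigma> xbar C0 x M Y E" if "minimal_chain w \<mu> x M Y E"
    for x and M :: "'w measure" and Y E
    using that by unfold_locales
  have "conservative TYPE('w) w \<mu>"
    unfolding conservative_def using diverging_chain.AE_lifetime_infinite[OF chain] by blast
  moreover have "upper_rate_function TYPE('w) w \<mu> xbar (adapted_path_metric w \<sigma>) psi_inv"
    unfolding upper_rate_function_def
  proof (intro conjI allI impI)
    show "0 \<le> psi_inv t" if "0 \<le> t" for t
      using psi_psi_inv[OF that] by (meson order_trans zero_le_numeral zero_le_power)
    show "mono_on {0..} psi_inv" by (auto intro!: mono_onI psi_inv_mono)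
  \<comment> \<open>\<open>dist0\<close> measures from \<open>xbar\<close>, the rate function
    measures to it; symmetry of the path metric identifies the two.\<close>
  qed (use diverging_chain.exists_settling_time[OF chain] in
      \<open>simp add: dist0_def adapted_path_metric_sym[of xbar]\<close>)
  moreover have "1 / 65536 * integral {4 ^ n0..R} (\<lambda>r. r * inv_log_plus
      (ball_measure \<mu> (adapted_path_metric w \<sigma>) xbar r) (ln (ln r))) = psi R" for R
    by (simp add: psi_def rate_integrand_def[abs_def] inv_log_plus_vol lv_def)
  ultimately show ?thesis
    unfolding Let_def
    by (intro conjI exI[of _ "1 / 65536"] exI[of _ "4 ^ n0"] exI[of _ psi_inv])
       (simp_all add: psi_psi_inv psi_nonneg psi_inv_psi)
qed

end
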